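(* Let $\varepsilon_1,\ldots,\varepsilon_k$ be $k$ nonnegative real numbers with $\varepsilon_1+\cdots +\varepsilon_k=1$. If $G$ is a graph and $\varepsilon_2=\cdots =\varepsilon_k$, then $G$ can be edge-decomposed into factors $G_1,\ldots, G_k$ such that (1) for all $v\in V(G)$ and all $1\le i\le k$, $|d_{G_i}(v)-\varepsilon_i d_G(v)|<2$; (2) for each $v\in V(G)$, there is at most one index $j_v$ with $d_{G_{j_v}}(v)$ odd. Furthermore, if $\varepsilon_1>0$ and $G$ is odd-$\lceil 1/\varepsilon_1\rceil $-edge-connected, then the factors can be chosen such that (1) and (2) hold and $j_v=1$ for all odd-degree vertices $v$.
   Context: Graphs may have loops and multiple edges; $d_G(v)$ is the degree of $v$ in $G$ (a loop counts twice). A factor of $G$ is a spanning subgraph of $G$; $G$ is edge-decomposed into factors if their edge sets partition $E(G)$. For a vertex set $A$, $d_G(A)$ is the number of edges of $G$ with exactly one end in $A$; $G$ is odd-$\lambda$-edge-connected if $d_G(A)\ge \lambda$ for every vertex set $A$ with $d_G(A)$ odd. *)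

theory Defs
  imports Complex_Main "HOL-Library.Uprod" "HOL-Library.Multiset" "HOL-Library.Disjoint_Sets"
begin

text \<open>Edges are abstract names, so parallel edges are distinct edges with the same ends;
  a loop at \<open>v\<close> is an edge with ends \<open>Upair v v\<close>.\<close>

record ('v, 'e) multigraph =
  verts :: "'v set"
  edges :: "'e set"
  ends :: "'e \<Rightarrow> 'v uprod"

locale finite_multigraph =
  fixes G :: "('v, 'e) multigraph"
  assumes finite_verts: "finite (verts G)"
    and finite_edges: "finite (edges G)"
    and ends_in_verts: "e \<in> edges G \<Longrightarrow> set_uprod (ends G e) \<subseteq> verts G"

definition end_multiplicity :: "'v uprod \<Rightarrow> 'v \<Rightarrow> nat" where
  "end_multiplicity p v = (if p = Upair v v then 2 else if v \<in> set_uprod p then 1 else 0)"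

definition degree :: "('v, 'e) multigraph \<Rightarrow> 'v \<Rightarrow> nat" where
  "degree G v = (\<Sum>e\<in>edges G. end_multiplicity (ends G e) v)"

definition cut_degree :: "('v, 'e) multigraph \<Rightarrow> 'v set \<Rightarrow> nat" where
  "cut_degree G A =
    card {e \<in> edges G. \<exists>x y. ends G e = Upair x y \<and> x \<in> A \<and> y \<notin> A}"

definition odd_edge_connected :: "('v, 'e) multigraph \<Rightarrow> int \<Rightarrow> bool" where
  "odd_edge_connected G l \<longleftrightarrow>
    (\<forall>A. A \<subseteq> verts G \<longrightarrow> odd (cut_degree G A) \<longrightarrow> l \<le> int (cut_degree G A))"

definition factor :: "('v, 'e) multigraph \<Rightarrow> ('v, 'e) multigraph \<Rightarrow> bool" where
  "factor H G \<longleftrightarrow> verts H = verts G \<and> edges H \<subseteq> edges G \<and>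
    (\<forall>e\<in>edges H. ends H e = ends G e)"

text \<open>The parts may have empty edge sets, so this is not \<open>partition_on\<close>: for instance a
  factor is forced to be edgeless when \<open>G\<close> has fewer edges than there are factors.\<close>

definition factor_decomposition ::
    "('v, 'e) multigraph \<Rightarrow> 'i set \<Rightarrow> ('i \<Rightarrow> ('v, 'e) multigraph) \<Rightarrow> bool" where
  "factor_decomposition G I H \<longleftrightarrow>
    (\<forall>i\<in>I. factor (H i) G) \<and>
    disjoint_family_on (\<lambda>i. edges (H i)) I \<and>
    (\<Union>i\<in>I. edges (H i)) = edges G"

end

theory Submission
  imports Defs
begin

text \<open>
Both halves of the theorem come from one existence result, \<open>factor_exists\<close>. Let edge weights \<open>x\<close> between
0 and 1 add up to an integer \<open>f v\<close> at every vertex, and suppose that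
\<open>x (cut - D) + (1 - x) (D) \<ge> 1\<close> whenever \<open>D\<close> is a subset of the cut of a vertex set \<open>C\<close> and \<open>f (C) + |D|\<close> is
odd. Then some edge set has degree \<open>f v\<close> at every vertex. To see this, replace every vertex by
a complete bipartite gadget, so that edge sets with degrees \<open>f\<close> become perfect matchings and \<open>x\<close> becomes a
fractional perfect matching. Without a perfect matching, Tutte's theorem (\<open>tutte_berge\<close>) yields a set \<open>U\<close>
whose removal leaves more than \<open>|U|\<close> odd pieces. When \<open>U\<close> is as small as possible
(\<open>tutte_minimal_barrier\<close>) it does not cut through the gadgets, and the inequalities say that every odd piece
is tied to \<open>U\<close> by a total weight of at least 1 (\<open>component_charge\<close>). Since a vertex of \<open>U\<close> carries total
weight 1, there are at most \<open>|U|\<close> pieces, a contradiction.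

For a highly odd-edge-connected graph, put the weight \<open>\<epsilon> 1\<close> on all edges, and at each vertex add
a loop that absorbs the difference between \<open>\<epsilon> 1\<close> times the degree and the next integer of the parity
of the degree. The inequalities hold: an odd cut has at least \<open>1 / \<epsilon> 1\<close> edges, and if \<open>D\<close> is not
empty, parity gives an edge of the cut outside \<open>D\<close>. This produces the first factor (\<open>parity_factor\<close>), with
degrees of the same parities as those of the graph, and it leaves even degrees for the others.

In bipartite graphs the inequalities hold automatically, and this special case says that real flows
in networks can be rounded to integral flows (\<open>flow_rounding\<close>). Rounding yields an orientation in
which in-degrees and out-degrees differ by at most 1, and then, for every \<open>c\<close> between 0 and 1, an edge set
that contains at every vertex the fraction \<open>c\<close> of the outgoing and of the incoming edges, and of the
difference of their numbers, up to an error less than 1 (\<open>proportional_subset_exists\<close>). Splitting off a first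
part with \<open>c = \<epsilon> 1\<close> and then equal parts one after another gives the decomposition. Two errors below 1
make an error below 2 in the degree; no part has a difference of the sign opposite to the total difference,
which is at most 1 in absolute value, so at most one of the differences is odd. As all weights but the first are
equal, the rounding errors of successive steps do not accumulate (\<open>rounding_trans\<close>).
\<close>

section \<open>Matchings and the Tutte-Berge formula\<close>

text \<open>Graphs in this section are simple: a vertex set together with a symmetric relation on it, so that
induced subgraphs arise by shrinking the vertex set alone.\<close>

definition matching :: "'a set \<Rightarrow> ('a \<Rightarrow> 'a \<Rightarrow> bool) \<Rightarrow> 'a set set \<Rightarrow> bool" where
  "matching V adj M \<longleftrightarrow> disjoint M \<and> (\<forall>e\<in>M. \<exists>a\<in>V. \<exists>b\<in>V. a \<noteq> b \<and> adj a b \<and> e = {a, b})"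

text \<open>A barrier certifies that matchings are small. The members of \<open>\<C>\<close> are only required to be odd and to
have no neighbours outside \<open>U\<close> and themselves; they may be unions of components of the graph
without \<open>U\<close>. This freedom makes barriers easy to merge.\<close>

definition barrier :: "'a set \<Rightarrow> ('a \<Rightarrow> 'a \<Rightarrow> bool) \<Rightarrow> 'a set \<Rightarrow> 'a set set \<Rightarrow> bool" where
  "barrier V adj U \<C> \<longleftrightarrow> U \<subseteq> V \<and> disjoint \<C> \<and> (\<forall>C\<in>\<C>. C \<subseteq> V - U \<and> odd (card C)) \<and>
     (\<forall>C\<in>\<C>. \<forall>c\<in>C. \<forall>d\<in>V - U - C. \<not> adj c d)"

lemma barrierI:
  assumes "disjoint \<C>" "\<forall>C\<in>\<C>. C \<subseteq> V - U \<and> odd (card C)"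
    "\<And>C c d. C \<in> \<C> \<Longrightarrow> c \<in> C \<Longrightarrow> d \<in> V - U - C \<Longrightarrow> \<not> adj c d" "U \<subseteq> V"
  shows "barrier V adj U \<C>"
  using assms unfolding barrier_def by simp

lemma barrier_subset: "barrier V adj U \<C> \<Longrightarrow> U \<subseteq> V"
  unfolding barrier_def by simp

lemma barrier_member:
  "barrier V adj U \<C> \<Longrightarrow> C \<in> \<C> \<Longrightarrow> C \<subseteq> V - U"
  "barrier V adj U \<C> \<Longrightarrow> C \<in> \<C> \<Longrightarrow> odd (card C)"
  unfolding barrier_def by simp_all

lemma barrier_disjoint:
  "barrier V adj U \<C> \<Longrightarrow> A \<in> \<C> \<Longrightarrow> B \<in> \<C> \<Longrightarrow> A \<noteq> B \<Longrightarrow> A \<inter> B = {}"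
  unfolding barrier_def disjoint_def by simp

lemma barrier_closed:
  "barrier V adj U \<C> \<Longrightarrow> C \<in> \<C> \<Longrightarrow> c \<in> C \<Longrightarrow> d \<in> V - U - C \<Longrightarrow> \<not> adj c d"
  unfolding barrier_def by simp

lemma barrier_finite:
  assumes "finite V" "barrier V adj U \<C>"
  shows "finite U \<and> finite \<C>"
proof -
  have "\<C> \<subseteq> Pow V" using barrier_member(1)[OF assms(2)] by blast
  then show ?thesis using barrier_subset[OF assms(2)] assms(1) by (meson finite_Pow_iff finite_subset)
qed

lemma matching_disjoint: "matching V adj M \<Longrightarrow> disjoint M"
  unfolding matching_def by simp

lemma matching_edgeE:
  assumes "matching V adj M" "e \<in> M"
  obtains a b where "a \<in> V" "b \<in> V" "a \<noteq> b" "adj a b" "e = {a, b}"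
  using assms unfolding matching_def by meson

lemma matching_Union_subset: "matching V adj M \<Longrightarrow> \<Union>M \<subseteq> V"
  by (fastforce elim: matching_edgeE)

lemma matching_finite: 
  assumes "finite V" "matching V adj M"
  shows "finite M"
proof -
  have "M \<subseteq> Pow V" using matching_Union_subset[OF assms(2)] by blast
  then show ?thesis using assms(1) by (meson finite_Pow_iff finite_subset)
qed

lemma matching_mono: "matching V adj M \<Longrightarrow> V \<subseteq> V' \<Longrightarrow> matching V' adj M"
  unfolding matching_def by (meson subsetD)

lemma matching_subset: "matching V adj M \<Longrightarrow> N \<subseteq> M \<Longrightarrow> matching V adj N"
  unfolding matching_def by (meson pairwise_subset subsetD)

lemma matching_union:
  assumes "matching V adj M" "matching W adj N" "\<Union>M \<inter> \<Union>N = {}"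
  shows "matching (V \<union> W) adj (M \<union> N)"
proof -
  have "disjoint (M \<union> N)"
    using matching_disjoint[OF assms(1)] matching_disjoint[OF assms(2)] assms(3) by (rule disjoint_union)
  then show ?thesis using matching_mono[OF assms(1), of "V \<union> W"] matching_mono[OF assms(2), of "V \<union> W"]
    unfolding matching_def by auto
qed

lemma matching_insert:
  assumes "matching V adj M" "a \<in> V" "b \<in> V" "a \<noteq> b" "adj a b" "a \<notin> \<Union>M" "b \<notin> \<Union>M"
  shows "matching V adj (insert {a, b} M)"
proof -
  have "matching V adj {{a, b}}" using assms unfolding matching_def by (auto simp: pairwise_def)
  from matching_union[OF assms(1) this] show ?thesis using assms by simp
qed

lemma matching_card_Union:
  assumes "matching V adj M"
  shows "card (\<Union>M) = 2 * card M"
proof -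
  have "card (\<Union>M) = sum card M"
  proof (rule card_Union_disjoint)
    show "pairwise disjnt M" using assms unfolding matching_def by simp
    show "finite A" if "A \<in> M" for A using assms that unfolding matching_def by force
  qed
  also have "\<dots> = (\<Sum>e\<in>M. 2)"
    by (intro sum.cong refl) (auto elim: matching_edgeE[OF assms])
  finally show ?thesis by simp
qed

lemma matching_edge_unique:
  "matching V adj M \<Longrightarrow> e \<in> M \<Longrightarrow> e' \<in> M \<Longrightarrow> a \<in> e \<Longrightarrow> a \<in> e' \<Longrightarrow> e = e'"
  using matching_disjoint[of V adj M] unfolding disjoint_def by blast

lemma matching_edge_of:
  assumes "matching V adj M" "symp adj" "a \<in> \<Union>M"
  obtains b where "{a, b} \<in> M" "a \<noteq> b" "a \<in> V" "b \<in> V" "adj a b"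
proof -
  obtain e where e: "e \<in> M" "a \<in> e" using assms(3) by blast
  obtain p q where "p \<in> V" "q \<in> V" "p \<noteq> q" "adj p q" "e = {p, q}"
    using matching_edgeE[OF assms(1) e(1)] .
  note pq = this
  show ?thesis
  proof (cases "a = p")
    case True
    then show ?thesis using that[of q] pq e by simp
  next
    case False
    then have "a = q" using e pq by blast
    then show ?thesis using that[of p] pq e sympD[OF assms(2)] by (auto simp: insert_commute)
  qed
qed

definition maximum_matching :: "'a set \<Rightarrow> ('a \<Rightarrow> 'a \<Rightarrow> bool) \<Rightarrow> 'a set set \<Rightarrow> bool" where
  "maximum_matching V adj M \<longleftrightarrow> matching V adj M \<and> (\<forall>N. matching V adj N \<longrightarrow> card N \<le> card M)"

lemma maximum_matching_exists:
  assumes "finite V"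
  obtains M where "maximum_matching V adj M"
proof -
  have bnd: "card N \<le> card V" if "matching V adj N" for N
    using matching_card_Union[OF that] card_mono[OF assms matching_Union_subset[OF that]] by linarith
  have "matching V adj {}" unfolding matching_def by simp
  then have "\<exists>M. matching V adj M \<and> (\<forall>N. matching V adj N \<longrightarrow> card N \<le> card M)"
    by (rule ex_has_greatest_nat[where f = card and b = "Suc (card V)"])
      (use bnd in \<open>auto simp: less_Suc_eq_le\<close>)
  then show ?thesis using that unfolding maximum_matching_def by blast
qed

text \<open>Gallai's lemma: the relation "no maximum matching misses both ends" is transitive. Suppose that
\<open>M\<close> misses \<open>u\<close> and \<open>v\<close>, and take \<open>N\<close> missing \<open>t\<close> with as much in common with \<open>M\<close> as
possible. Since \<open>N\<close> covers \<open>u\<close> and \<open>v\<close> while both matchings have the same size, \<open>M\<close> covers some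
\<open>p \<noteq> t\<close> that \<open>N\<close> misses. Exchanging one edge of \<open>N\<close> for the \<open>M\<close>-edge at \<open>p\<close> keeps \<open>t\<close> uncovered
and gains an edge of \<open>M\<close>.\<close>

lemma gallai_transitive:
  assumes fin: "finite V" and sym: "symp adj"
    and M: "maximum_matching V adj M" "u \<notin> \<Union>M" "v \<notin> \<Union>M" "u \<in> V" "v \<in> V" "u \<noteq> v"
    and ut: "\<And>N. maximum_matching V adj N \<Longrightarrow> t \<notin> \<Union>N \<Longrightarrow> u \<in> \<Union>N"
    and vt: "\<And>N. maximum_matching V adj N \<Longrightarrow> t \<notin> \<Union>N \<Longrightarrow> v \<in> \<Union>N"
    and N0: "maximum_matching V adj N0" "t \<notin> \<Union>N0"
  shows False
proof -
  have mM: "matching V adj M" and maxM: "\<And>N. matching V adj N \<Longrightarrow> card N \<le> card M"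
    using M(1) unfolding maximum_matching_def by auto
  have finM: "finite M" using matching_finite[OF fin mM] .
  define P where "P N \<longleftrightarrow> maximum_matching V adj N \<and> t \<notin> \<Union>N" for N
  have "\<exists>N. P N \<and> (\<forall>N'. P N' \<longrightarrow> card (M \<inter> N') \<le> card (M \<inter> N))"
    by (rule ex_has_greatest_nat[where b = "Suc (card M)" and k = N0])
      (use N0 finM in \<open>auto simp: P_def less_Suc_eq_le intro!: card_mono\<close>)
  then obtain N where N: "maximum_matching V adj N" "t \<notin> \<Union>N"
    and best: "\<And>N'. maximum_matching V adj N' \<Longrightarrow> t \<notin> \<Union>N' \<Longrightarrow> card (M \<inter> N') \<le> card (M \<inter> N)"
    unfolding P_def by blast
  have mN: "matching V adj N" and maxN: "\<And>N'. matching V adj N' \<Longrightarrow> card N' \<le> card N"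
    using N(1) unfolding maximum_matching_def by auto
  have finN: "finite N" using matching_finite[OF fin mN] .
  have cMN: "card M = card N" using maxM[OF mN] maxN[OF mM] by simp
  have finU: "finite (\<Union>M)" "finite (\<Union>N)"
    using matching_Union_subset[OF mM] matching_Union_subset[OF mN] fin finite_subset by blast+
  have uN: "u \<in> \<Union>N" and vN: "v \<in> \<Union>N" using ut[OF N] vt[OF N] by auto
  have "\<not> \<Union>M - \<Union>N \<subseteq> {t}"
  proof
    assume "\<Union>M - \<Union>N \<subseteq> {t}"
    then have "card (\<Union>M - \<Union>N) \<le> 1" using card_mono[of "{t}"] by simp
    moreover have "card {u, v} \<le> card (\<Union>N - \<Union>M)"
      by (rule card_mono) (use uN vN M finU in auto)
    moreover have "card (\<Union>M - \<Union>N) + card (\<Union>M \<inter> \<Union>N) = card (\<Union>M)"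
      using finU by (metis Int_commute card_Diff_subset_Int card_mono inf.cobounded1 le_add_diff_inverse2 finite_Int)
    moreover have "card (\<Union>N - \<Union>M) + card (\<Union>M \<inter> \<Union>N) = card (\<Union>N)"
      using finU by (metis Int_commute card_Diff_subset_Int card_mono inf.cobounded1 le_add_diff_inverse2 finite_Int)
    ultimately show False
      using matching_card_Union[OF mM] matching_card_Union[OF mN] cMN \<open>u \<noteq> v\<close> by simp
  qed
  then obtain p where p: "p \<in> \<Union>M" "p \<notin> \<Union>N" "p \<noteq> t" by blast
  obtain q where q: "{p, q} \<in> M" "p \<noteq> q" "p \<in> V" "q \<in> V" "adj p q"
    using matching_edge_of[OF mM sym p(1)] .
  \<comment> \<open>\<open>N\<close> covers the mate of \<open>p\<close>, or it could be enlarged; the edge of \<open>N\<close> there is the one to give up.\<close>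
  have qN: "q \<in> \<Union>N"
  proof (rule ccontr)
    assume "q \<notin> \<Union>N"
    from matching_insert[OF mN q(3,4,2,5) p(2) this]
    have "card (insert {p, q} N) \<le> card N" by (rule maxN)
    moreover have "{p, q} \<notin> N" using p(2) by blast
    ultimately show False using finN by simp
  qed
  then obtain g where g: "g \<in> N" "q \<in> g" by blast
  have gM: "g \<notin> M"
  proof
    assume "g \<in> M"
    then have "g = {p, q}" using matching_edge_unique[OF mM _ q(1) g(2)] by simp
    then show False using g(1) p(2) by blast
  qed
  define N' where "N' = insert {p, q} (N - {g})"
  have pqN: "{p, q} \<notin> N" using p(2) by blast
  have qNg: "q \<notin> \<Union>(N - {g})" using matching_edge_unique[OF mN _ g(1) _ g(2)] by blast
  have mN': "matching V adj N'" unfolding N'_def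
    by (rule matching_insert[OF matching_subset[OF mN] q(3,4,2,5)]) (use p qNg in auto)
  have "card N' = card N" unfolding N'_def using finN g(1) pqN
    by (metis DiffD1 card_Suc_Diff1 card_insert_disjoint finite_Diff)
  then have "maximum_matching V adj N'"
    using mN' maxN unfolding maximum_matching_def by simp
  moreover have "t \<notin> \<Union>N'" using N(2) p(3) qN unfolding N'_def by auto
  ultimately have "card (M \<inter> N') \<le> card (M \<inter> N)" by (rule best)
  moreover have "M \<inter> N' = insert {p, q} (M \<inter> N)" using q(1) gM unfolding N'_def by blast
  ultimately show False using finM pqN by simp
qed

text \<open>The hard half of the Tutte-Berge formula, by induction on the vertex set. A vertex that lies on
every maximum matching can be deleted and put into \<open>U\<close>. Otherwise the relation of Gallai's lemma
is an equivalence that contains adjacency. If it has several classes, the graph falls apart along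
one of them; if it has a single class, a maximum matching misses at most one vertex.\<close>

theorem tutte_berge:
  assumes "finite V" and sym: "symp adj"
  shows "\<exists>U \<C> M. barrier V adj U \<C> \<and> matching V adj M \<and> card V + card U \<le> card \<C> + 2 * card M"
  using assms(1)
proof (induction V rule: finite_psubset_induct)
  case (psubset V)
  note fin = \<open>finite V\<close>
  have IH: "\<exists>U \<C> M. barrier W adj U \<C> \<and> matching W adj M \<and> card W + card U \<le> card \<C> + 2 * card M"
    if "W \<subset> V" for W using psubset.IH[OF that] .
  obtain M where M: "maximum_matching V adj M" using maximum_matching_exists[OF fin] .
  then have mM: "matching V adj M" unfolding maximum_matching_def by simp
  consider (essential) v where "v \<in> V" "\<And>N. maximum_matching V adj N \<Longrightarrow> v \<in> \<Union>N"
    | (inessential) "\<And>v. v \<in> V \<Longrightarrow> \<exists>N. maximum_matching V adj N \<and> v \<notin> \<Union>N" by blast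
  then show ?case
  proof cases
    case (essential v)
    have sub: "V - {v} \<subset> V" using essential by blast
    obtain U \<C> N where *: "barrier (V - {v}) adj U \<C>" "matching (V - {v}) adj N"
      "card (V - {v}) + card U \<le> card \<C> + 2 * card N" using IH[OF sub] by blast
    have mN: "matching V adj N" using matching_mono[OF *(2)] by blast
    have vN: "v \<notin> \<Union>N" using matching_Union_subset[OF *(2)] by blast
    have "card N < card M"
    proof (rule ccontr)
      assume "\<not> card N < card M"
      then have "maximum_matching V adj N"
        using M mN unfolding maximum_matching_def by (meson le_trans linorder_not_less)
      then show False using essential(2) vN by blast
    qed
    moreover have "barrier V adj (insert v U) \<C>"
    proof -
      have "V - insert v U = V - {v} - U" by blast
      moreover have "insert v U \<subseteq> V" using barrier_subset[OF *(1)] essential(1) by blast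
      ultimately show ?thesis using *(1) unfolding barrier_def by simp
    qed
    moreover have "finite U" "v \<notin> U"
      using barrier_subset[OF *(1)] finite_subset[OF _ fin, of U] by blast+
    moreover have "card V = Suc (card (V - {v}))" using card_Suc_Diff1[OF fin essential(1)] by simp
    moreover have "card (insert v U) = Suc (card U)" using calculation(3,4) by simp
    ultimately have "barrier V adj (insert v U) \<C> \<and> matching V adj M
        \<and> card V + card (insert v U) \<le> card \<C> + 2 * card M"
      using *(3) mM by linarith
    then show ?thesis by blast
  next
    case inessential
    show ?thesis
    proof (cases "V = {}")
      case True
      then show ?thesis
        by (intro exI[of _ "{}"] exI[of _ "{}"]) (simp add: barrier_def matching_def)
    next
      case False
      then obtain u where u: "u \<in> V" by blast
      define R where "R a b \<longleftrightarrow> a = b \<or> (\<forall>N. maximum_matching V adj N \<longrightarrow> a \<in> \<Union>N \<or> b \<in> \<Union>N)" for a b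
      have Rtrans: "R a c" if "R a b" "R b c" "a \<in> V" "b \<in> V" "c \<in> V" for a b c
      proof (rule ccontr)
        assume n: "\<not> R a c"
        then obtain N where N: "maximum_matching V adj N" "a \<notin> \<Union>N" "c \<notin> \<Union>N" "a \<noteq> c"
          unfolding R_def by blast
        obtain N0 where N0: "maximum_matching V adj N0" "b \<notin> \<Union>N0"
          using inessential[OF \<open>b \<in> V\<close>] by blast
        have ne: "a \<noteq> b" "b \<noteq> c" using n that by auto
        show False
          by (rule gallai_transitive[OF fin sym N(1,2,3) that(3,5) N(4) _ _ N0])
            (use that ne in \<open>auto simp: R_def\<close>)
      qed
      have Radj: "R a b" if "adj a b" "a \<in> V" "b \<in> V" for a b
      proof (rule ccontr)
        assume "\<not> R a b"
        then obtain N where N: "maximum_matching V adj N" "a \<notin> \<Union>N" "b \<notin> \<Union>N" "a \<noteq> b"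
          unfolding R_def by blast
        then have "matching V adj (insert {a, b} N)"
          using matching_insert that unfolding maximum_matching_def by metis
        then have "card (insert {a, b} N) \<le> card N" using N(1) unfolding maximum_matching_def by blast
        moreover have "{a, b} \<notin> N" using N by blast
        moreover have "finite N" using N(1) matching_finite[OF fin] unfolding maximum_matching_def by blast
        ultimately show False by simp
      qed
      define K where "K = {w \<in> V. R u w}"
      have uK: "u \<in> K" using u unfolding K_def R_def by simp
      have closed: "\<not> adj a b" if "a \<in> K" "b \<in> V - K" for a b
        using that Radj Rtrans u unfolding K_def by blast
      show ?thesis
      proof (cases "K = V")
        case True
        obtain N where N: "maximum_matching V adj N" "u \<notin> \<Union>N" using inessential u by blast
        have mN: "matching V adj N" using N unfolding maximum_matching_def by simp
        have "V - {u} \<subseteq> \<Union>N"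
        proof
          fix w assume w: "w \<in> V - {u}"
          then have "R u w" using True unfolding K_def by blast
          then show "w \<in> \<Union>N" using w N unfolding R_def by blast
        qed
        then have "card (V - {u}) \<le> card (\<Union>N)"
          using fin matching_Union_subset[OF mN] by (meson card_mono finite_subset)
        then have le: "card V \<le> Suc (2 * card N)"
          using matching_card_Union[OF mN] card_Suc_Diff1[OF fin u] by simp
        show ?thesis
        proof (cases "odd (card V)")
          case True
          have "barrier V adj {} {V}" using True unfolding barrier_def by auto
          then show ?thesis using le mN by (intro exI[of _ "{}"] exI[of _ "{V}"] exI[of _ N]) simp
        next
          case False
          have "barrier V adj {} {}" unfolding barrier_def by auto
          moreover have "card V \<le> 2 * card N" using False le by presburger
          ultimately show ?thesis using mN by (intro exI[of _ "{}"] exI[of _ N]) simp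
        qed
      next
        case False
        have KV: "K \<subset> V" using False unfolding K_def by blast
        have KV': "V - K \<subset> V" using uK KV by blast
        obtain U1 C1 M1 where 1: "barrier K adj U1 C1" "matching K adj M1"
          "card K + card U1 \<le> card C1 + 2 * card M1" using IH[OF KV] by blast
        obtain U2 C2 M2 where 2: "barrier (V - K) adj U2 C2" "matching (V - K) adj M2"
          "card (V - K) + card U2 \<le> card C2 + 2 * card M2" using IH[OF KV'] by blast
        have finK: "finite K" "finite (V - K)" using fin KV finite_subset by blast+
        have closed': "\<not> adj b a" if "a \<in> K" "b \<in> V - K" for a b
          using closed[OF that] sym by (meson sympD)
        have finU: "finite U1" "finite U2" "finite C1" "finite C2"
          using barrier_finite[OF finK(1) 1(1)] barrier_finite[OF finK(2) 2(1)] by auto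
        have sub1: "\<Union>C1 \<subseteq> K" "U1 \<subseteq> K" "\<Union>M1 \<subseteq> K" 
          using barrier_member(1)[OF 1(1)] barrier_subset[OF 1(1)] matching_Union_subset[OF 1(2)] by blast+
        have sub2: "\<Union>C2 \<subseteq> V - K" "U2 \<subseteq> V - K" "\<Union>M2 \<subseteq> V - K"
          using barrier_member(1)[OF 2(1)] barrier_subset[OF 2(1)] matching_Union_subset[OF 2(2)] by blast+
        have ne: "{} \<notin> C1" "{} \<notin> C2"
          using barrier_member(2)[OF 1(1), of "{}"] barrier_member(2)[OF 2(1), of "{}"] by auto
        have neM: "{} \<notin> M1" by (auto elim: matching_edgeE[OF 1(2)])
        have dj: "A \<inter> B = {}" if "\<Union>A \<subseteq> K" "\<Union>B \<subseteq> V - K" "{} \<notin> A" for A B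
        proof -
          have "x = {}" if "x \<subseteq> K" "x \<subseteq> V - K" for x using that by blast
          then show ?thesis using that by (metis Int_iff Sup_le_iff equals0I)
        qed
        have "U1 \<inter> U2 = {}" using sub1(2) sub2(2) by blast
        moreover note dj[OF sub1(1) sub2(1) ne(1)] dj[OF sub1(3) sub2(3) neM]
        ultimately have cards: "card (U1 \<union> U2) = card U1 + card U2" "card (C1 \<union> C2) = card C1 + card C2"
          "card (M1 \<union> M2) = card M1 + card M2"
          using finU matching_finite[OF finK(1) 1(2)] matching_finite[OF finK(2) 2(2)]
          by (auto intro!: card_Un_disjoint)
        have "\<Union>C1 \<inter> \<Union>C2 = {}" using sub1(1) sub2(1) by blast
        then have "disjoint (C1 \<union> C2)"
          using 1(1) 2(1) unfolding barrier_def by (simp add: disjoint_union)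
        moreover have "\<forall>C\<in>C1 \<union> C2. C \<subseteq> V - (U1 \<union> U2) \<and> odd (card C)"
          using barrier_member[OF 1(1)] barrier_member[OF 2(1)] sub1 sub2 KV by blast
        moreover have "\<not> adj c d" if "C \<in> C1 \<union> C2" "c \<in> C" "d \<in> V - (U1 \<union> U2) - C" for C c d
        proof (cases "C \<in> C1")
          case True
          then have "c \<in> K" using sub1 that by blast
          then show ?thesis
            using 1(1) that True closed[of c d] unfolding barrier_def by (cases "d \<in> K") auto
        next
          case False
          then have C: "C \<in> C2" using that by blast
          then have "c \<in> V - K" using sub2 that by blast
          then show ?thesis
            using 2(1) that C closed'[of d c] unfolding barrier_def by (cases "d \<in> K") auto
        qed
        moreover have "U1 \<union> U2 \<subseteq> V" using sub1 sub2 KV by blast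
        ultimately have "barrier V adj (U1 \<union> U2) (C1 \<union> C2)" by (rule barrierI)
        moreover have "matching V adj (M1 \<union> M2)"
        proof -
          have "K \<union> (V - K) = V" using KV by blast
          then show ?thesis using matching_union[OF 1(2) 2(2)] sub1 sub2 by fastforce
        qed
        moreover have "card V = card K + card (V - K)"
          using fin KV by (metis card_Diff_subset card_mono finK(1) le_add_diff_inverse psubset_imp_subset)
        ultimately show ?thesis using 1(3) 2(3) cards
          by (intro exI[of _ "U1 \<union> U2"] exI[of _ "C1 \<union> C2"] exI[of _ "M1 \<union> M2"]) simp
      qed
    qed
  qed
qed

text \<open>With \<open>\<C>\<close> a partition of the vertices outside \<open>U\<close>, every neighbour outside \<open>U\<close> lies in some member.
The surplus of two is what parity makes of a surplus of one when the number of vertices is even.\<close>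

definition covering_barrier :: "'a set \<Rightarrow> ('a \<Rightarrow> 'a \<Rightarrow> bool) \<Rightarrow> 'a set \<Rightarrow> 'a set set \<Rightarrow> bool" where
  "covering_barrier V adj U \<C> \<longleftrightarrow> barrier V adj U \<C> \<and> \<Union>\<C> = V - U \<and> card U + 2 \<le> card \<C>"

text \<open>The vertices left over by a barrier have no neighbours in its members, so they form a further
member if their number is odd and can be added to any member if it is even.\<close>

lemma covering_barrier_exists:
  assumes fin: "finite V" and sym: "symp adj" and ev: "even (card V)"
    and no: "\<And>M. matching V adj M \<Longrightarrow> \<Union>M \<noteq> V"
  shows "\<exists>U \<C>. covering_barrier V adj U \<C>"
proof -
  obtain U \<C> M where b: "barrier V adj U \<C>" and M: "matching V adj M"
    and le: "card V + card U \<le> card \<C> + 2 * card M"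
    using tutte_berge[OF fin sym] by blast
  have "card (\<Union>M) < card V"
    using no[OF M] matching_Union_subset[OF M] fin by (meson psubsetI psubset_card_mono)
  then have "2 * card M + 2 \<le> card V" using ev matching_card_Union[OF M] by presburger
  then have big: "card U + 2 \<le> card \<C>" using le by linarith
  have finU: "finite U" "finite \<C>" using barrier_finite[OF fin b] by auto
  define R where "R = V - U - \<Union>\<C>"
  have Rcl: "\<not> adj c d" "\<not> adj d c" if "c \<in> R" "d \<in> V - U - R" for c d
    using b that sym unfolding R_def barrier_def by (auto dest: sympD)
  have finR: "finite R" using fin unfolding R_def by simp
  show ?thesis
  proof (cases "odd (card R)")
    case True
    then have "R \<noteq> {}" by auto
    then have notin: "R \<notin> \<C>" unfolding R_def by blast
    have "disjoint (insert R \<C>)"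
      using b unfolding barrier_def R_def by (auto simp: pairwise_insert disjnt_def)
    moreover have "\<forall>C\<in>insert R \<C>. C \<subseteq> V - U \<and> odd (card C)"
      using barrier_member[OF b] True unfolding R_def by blast
    moreover have "\<not> adj c d" if "C \<in> insert R \<C>" "c \<in> C" "d \<in> V - U - C" for C c d
      using that barrier_closed[OF b, of C c d] Rcl(1)[of c d] by blast
    ultimately have "barrier V adj U (insert R \<C>)" using barrier_subset[OF b] by (rule barrierI)
    moreover have "\<Union>(insert R \<C>) = V - U" using barrier_member(1)[OF b] unfolding R_def by blast
    ultimately show ?thesis using big notin finU unfolding covering_barrier_def
      by (intro exI[of _ U] exI[of _ "insert R \<C>"]) simp
  next
    case False
    obtain C0 where C0: "C0 \<in> \<C>" using big by fastforce
    define \<D> where "\<D> = insert (C0 \<union> R) (\<C> - {C0})"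
    have dis: "C \<inter> C0 = {}" if "C \<in> \<C> - {C0}" for C
      using barrier_disjoint[OF b, of C C0] that C0 by blast
    have C0ne: "C0 \<noteq> {}" using barrier_member(2)[OF b C0] by auto
    have notin: "C0 \<union> R \<notin> \<C> - {C0}" using dis C0ne by blast
    have fin0: "finite C0" using barrier_member(1)[OF b C0] fin by (meson finite_Diff finite_subset)
    have "card (C0 \<union> R) = card C0 + card R"
      by (rule card_Un_disjoint) (use fin0 finR C0 in \<open>auto simp: R_def\<close>)
    then have odd0: "odd (card (C0 \<union> R))" using False barrier_member(2)[OF b C0] by simp
    have "disjoint \<D>" unfolding \<D>_def pairwise_insert
      using b dis unfolding barrier_def R_def by (auto simp: disjnt_def pairwise_def)
    moreover have "\<not> adj c d" if "C \<in> \<D>" "c \<in> C" "d \<in> V - U - C" for C c d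
    proof (cases "c \<in> R")
      case True
      then have "C = C0 \<union> R" using that unfolding \<D>_def R_def by auto
      then show ?thesis using True Rcl that by blast
    next
      case False
      define C' where "C' = (if C = C0 \<union> R then C0 else C)"
      have "C' \<in> \<C>" "c \<in> C'" "C' \<subseteq> C"
        using that(1,2) False C0 unfolding \<D>_def C'_def by auto
      then show ?thesis using barrier_closed[OF b, of C' c d] that(3) by blast
    qed
    moreover have "\<forall>C\<in>\<D>. C \<subseteq> V - U \<and> odd (card C)"
      using barrier_member[OF b] C0 odd0 unfolding \<D>_def R_def by auto
    ultimately have "barrier V adj U \<D>" using barrier_subset[OF b] unfolding barrier_def by simp
    moreover have "\<Union>\<D> = V - U" using barrier_member(1)[OF b] C0 unfolding \<D>_def R_def by blast
    moreover have "card \<D> = card \<C>" unfolding \<D>_def using notin finU C0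
      by (metis card_Suc_Diff1 card_insert_disjoint finite_Diff)
    ultimately have "covering_barrier V adj U \<D>" using big unfolding covering_barrier_def by simp
    then show ?thesis by blast
  qed
qed

text \<open>In a barrier with the smallest possible \<open>U\<close>, no \<open>u \<in> U\<close> has its neighbours outside \<open>U\<close> confined to two
members: merging \<open>u\<close> with these two would give an odd set, and both \<open>U\<close> and the family would lose
exactly one element. This minimality is what later keeps barriers from cutting through a gadget.\<close>

theorem tutte_minimal_barrier:
  assumes fin: "finite V" and sym: "symp adj" and ev: "even (card V)"
    and no: "\<And>M. matching V adj M \<Longrightarrow> \<Union>M \<noteq> V"
  obtains U \<C> where "barrier V adj U \<C>" "\<Union>\<C> = V - U" "card U < card \<C>"
    "\<And>u C1 C2. u \<in> U \<Longrightarrow> C1 \<in> \<C> \<Longrightarrow> C2 \<in> \<C> \<Longrightarrow> \<exists>w\<in>V - U. adj u w \<and> w \<notin> C1 \<and> w \<notin> C2"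
proof -
  define P where "P n \<longleftrightarrow> (\<exists>U \<C>. covering_barrier V adj U \<C> \<and> card U = n)" for n
  have "\<exists>n. P n" using covering_barrier_exists[OF assms] unfolding P_def by blast
  then obtain n where n: "P n" "\<And>m. m < n \<Longrightarrow> \<not> P m" using exists_least_iff[of P] by blast
  obtain U \<C> where cb: "covering_barrier V adj U \<C>" and cU: "card U = n" using n(1) unfolding P_def by blast
  have b: "barrier V adj U \<C>" and cov: "\<Union>\<C> = V - U" and big: "card U + 2 \<le> card \<C>"
    using cb unfolding covering_barrier_def by auto
  have finU: "finite U" "finite \<C>" using barrier_finite[OF fin b] by auto
  have *: False if u: "u \<in> U" and C: "C1 \<in> \<C>" "C2 \<in> \<C>" "C1 \<noteq> C2"
    and nb: "\<And>w. w \<in> V - U \<Longrightarrow> adj u w \<Longrightarrow> w \<in> C1 \<union> C2" for u C1 C2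
  proof -
    define C where "C = insert u (C1 \<union> C2)"
    define \<D> where "\<D> = insert C (\<C> - {C1, C2})"
    have djC: "disjoint \<C>" using b unfolding barrier_def by simp
    have uV: "u \<in> V" "u \<notin> \<Union>\<C>" using u barrier_subset[OF b] cov by blast+
    have sub: "C1 \<subseteq> V - U" "C2 \<subseteq> V - U" and oddC: "odd (card C1)" "odd (card C2)"
      using barrier_member[OF b] C by blast+
    have finC: "finite C1" "finite C2" using sub fin by (meson finite_Diff finite_subset)+
    have dis: "A \<inter> B = {}" if "A \<in> \<C>" "B \<in> \<C>" "A \<noteq> B" for A B
      using barrier_disjoint[OF b that] .
    have "card C = Suc (card C1 + card C2)"
      unfolding C_def using finC uV C dis[OF C] by (subst card_insert_disjoint) (auto simp: card_Un_disjoint)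
    then have odd: "odd (card C)" using oddC by simp
    have notin: "C \<notin> \<C>" using uV unfolding C_def by blast
    have "disjoint \<D>"
    proof -
      have "C \<inter> B = {}" if "B \<in> \<C> - {C1, C2}" for B
        using that dis C uV unfolding C_def by blast
      then show ?thesis unfolding \<D>_def pairwise_insert
        using pairwise_subset[OF djC, of "\<C> - {C1, C2}"] by (auto simp: disjnt_def)
    qed
    moreover have "\<forall>B\<in>\<D>. B \<subseteq> V - (U - {u}) \<and> odd (card B)"
      using barrier_member[OF b] odd uV sub unfolding \<D>_def C_def by auto
    moreover have "\<not> adj c d" if "B \<in> \<D>" "c \<in> B" "d \<in> V - (U - {u}) - B" for B c d
    proof
      assume ad: "adj c d"
      show False
      proof (cases "c = u")
        case True
        then have "B = C" using that uV unfolding \<D>_def by auto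
        then show False using nb[of d] ad that True unfolding C_def by auto
      next
        case False
        then have "\<exists>B'. B' \<in> \<C> \<and> c \<in> B' \<and> B' \<subseteq> B \<and> (B \<noteq> C \<longrightarrow> B' = B)"
        proof (cases "B = C")
          case True
          then show ?thesis using that(2) C \<open>c \<noteq> u\<close> unfolding C_def by auto
        next
          case B: False
          then show ?thesis using that(1,2) unfolding \<D>_def by auto
        qed
        then obtain B' where B': "B' \<in> \<C>" "c \<in> B'" "B' \<subseteq> B" "B \<noteq> C \<longrightarrow> B' = B" by blast
        have "c \<in> V - U" using B' barrier_member(1)[OF b] by blast
        show False
        proof (cases "d = u")
          case True
          then have "c \<in> C1 \<union> C2" using nb[OF \<open>c \<in> V - U\<close>] sympD[OF sym ad] by simp
          moreover have "B \<noteq> C" using True that unfolding C_def by auto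
          then have "B \<in> \<C>" "B \<noteq> C1" "B \<noteq> C2" using that unfolding \<D>_def by auto
          ultimately show False using dis[of B C1] dis[of B C2] C that(2) by blast
        next
          case False
          then have "d \<in> V - U - B'" using that B' by blast
          then show False using barrier_closed[OF b B'(1,2)] ad by blast
        qed
      qed
    qed
    moreover have "U - {u} \<subseteq> V" using barrier_subset[OF b] by blast
    ultimately have "barrier V adj (U - {u}) \<D>" by (rule barrierI)
    moreover have "\<Union>\<D> = V - (U - {u})"
    proof -
      have "\<Union>\<D> = insert u (\<Union>\<C>)" unfolding \<D>_def C_def using C by blast
      also have "\<dots> = V - (U - {u})" unfolding cov using uV(1) u by auto
      finally show ?thesis .
    qed
    moreover have "card \<D> = card \<C> - 1"
    proof -
      have "card (\<C> - {C1, C2}) = card \<C> - 2" using C finU by (simp add: card_Diff_subset)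
      moreover have "card \<D> = Suc (card (\<C> - {C1, C2}))" unfolding \<D>_def using notin finU by simp
      ultimately show ?thesis using big by simp
    qed
    moreover have "card (U - {u}) = card U - 1" "card U > 0" using u finU by (auto simp: card_gt_0_iff)
    ultimately have "P (card U - 1)" unfolding P_def covering_barrier_def using big
      by (intro exI[of _ "U - {u}"] exI[of _ \<D>]) auto
    then show False using n(2) cU \<open>card U > 0\<close> by simp
  qed
  show ?thesis
  proof (rule that[OF b cov])
    show "card U < card \<C>" using big by simp
    show "\<exists>w\<in>V - U. adj u w \<and> w \<notin> C1 \<and> w \<notin> C2" if "u \<in> U" "C1 \<in> \<C>" "C2 \<in> \<C>" for u C1 C2
    proof -
      have "\<exists>C3. C3 \<in> \<C> \<and> C3 \<noteq> C1"
      proof (rule ccontr)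
        assume "\<not> ?thesis"
        then have "\<C> \<subseteq> {C1}" by blast
        then show False using big card_mono[of "{C1}" \<C>] by simp
      qed
      then have "\<exists>C3. C3 \<in> \<C> \<and> C3 \<noteq> C1 \<and> (C2 \<noteq> C1 \<longrightarrow> C3 = C2)"
        using that(3) by (cases "C2 = C1") auto
      then obtain C3 where C3: "C3 \<in> \<C>" "C3 \<noteq> C1" "C2 \<noteq> C1 \<longrightarrow> C3 = C2" by blast
      from *[OF that(1,2) C3(1)] C3 show ?thesis by blast
    qed
  qed
qed

section \<open>Half-edges, degrees and cuts\<close>

text \<open>From here on a multigraph is an edge set with a function \<open>en\<close> that gives the two ends \<open>en e False\<close>
and \<open>en e True\<close> of an edge. Counting half-edges lets a loop count twice without a case distinction,
and the same function serves as an orientation, \<open>False\<close> marking the tail and \<open>True\<close> the head.\<close>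

definition half_edges :: "('e \<Rightarrow> bool \<Rightarrow> 'v) \<Rightarrow> 'e set \<Rightarrow> 'v \<Rightarrow> ('e \<times> bool) set" where
  "half_edges en F v = {p \<in> F \<times> UNIV. en (fst p) (snd p) = v}"

definition deg :: "('e \<Rightarrow> bool \<Rightarrow> 'v) \<Rightarrow> 'e set \<Rightarrow> 'v \<Rightarrow> nat" where
  "deg en F v = card (half_edges en F v)"

definition edge_cut :: "('e \<Rightarrow> bool \<Rightarrow> 'v) \<Rightarrow> 'e set \<Rightarrow> 'v set \<Rightarrow> 'e set" where
  "edge_cut en F C = {e \<in> F. (en e False \<in> C) \<noteq> (en e True \<in> C)}"

lemma finite_half_edges [simp]: "finite F \<Longrightarrow> finite (half_edges en F v)"
  unfolding half_edges_def by simp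

lemma finite_edge_cut [simp]: "finite F \<Longrightarrow> finite (edge_cut en F C)"
  unfolding edge_cut_def by simp

lemma sum_over_ends:
  fixes g :: "'e \<Rightarrow> bool \<Rightarrow> 'a::comm_monoid_add"
  assumes "finite F"
  shows "(\<Sum>p\<in>F \<times> UNIV. g (fst p) (snd p)) = (\<Sum>e\<in>F. g e False + g e True)"
proof -
  have "(\<Sum>p\<in>F \<times> UNIV. g (fst p) (snd p)) = (\<Sum>e\<in>F. \<Sum>b\<in>UNIV. g e b)"
    by (simp add: sum.cartesian_product case_prod_beta')
  then show ?thesis by (simp add: UNIV_bool add.commute)
qed

lemma sum_half_edges:
  fixes g :: "'e \<Rightarrow> bool \<Rightarrow> 'a::comm_monoid_add"
  assumes "finite F"
  shows "(\<Sum>p\<in>half_edges en F v. g (fst p) (snd p)) =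
    (\<Sum>e\<in>F. (if en e False = v then g e False else 0) + (if en e True = v then g e True else 0))"
proof -
  have "(\<Sum>p\<in>half_edges en F v. g (fst p) (snd p)) =
      (\<Sum>p\<in>F \<times> UNIV. if en (fst p) (snd p) = v then g (fst p) (snd p) else 0)"
    unfolding half_edges_def using assms by (intro sum.inter_filter) simp
  then show ?thesis
    using sum_over_ends[OF assms, of "\<lambda>e b. if en e b = v then g e b else 0"] by simp
qed

lemma deg_eq_sum:
  "finite F \<Longrightarrow> deg en F v = (\<Sum>e\<in>F. (if en e False = v then 1 else 0) + (if en e True = v then 1 else 0))"
  unfolding deg_def using sum_half_edges[of F "\<lambda>_ _. 1::nat" en v] by simp

lemma sum_sum_half_edges:
  fixes g :: "'e \<Rightarrow> bool \<Rightarrow> 'a::comm_monoid_add"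
  assumes "finite F" "finite C"
  shows "(\<Sum>v\<in>C. \<Sum>p\<in>half_edges en F v. g (fst p) (snd p)) =
    (\<Sum>e\<in>F. (if en e False \<in> C then g e False else 0) + (if en e True \<in> C then g e True else 0))"
proof -
  have "(\<Sum>v\<in>C. \<Sum>p\<in>half_edges en F v. g (fst p) (snd p)) =
     (\<Sum>e\<in>F. \<Sum>v\<in>C. (if en e False = v then g e False else 0) + (if en e True = v then g e True else 0))"
    unfolding sum_half_edges[OF assms(1)] by (rule sum.swap)
  then show ?thesis using assms(2) by (simp add: sum.distrib)
qed

text \<open>An edge contributes two to the degree sum over \<open>C\<close> unless it leaves or avoids \<open>C\<close>.\<close>

lemma handshake_parity:
  assumes "finite F" "finite C"
  shows "even ((\<Sum>v\<in>C. deg en F v) + card (edge_cut en F C))"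
proof -
  have "(\<Sum>v\<in>C. deg en F v) = (\<Sum>e\<in>F. (if en e False \<in> C then 1 else 0) + (if en e True \<in> C then 1 else 0))"
    unfolding deg_def using sum_sum_half_edges[OF assms, where g = "\<lambda>_ _. 1::nat" and en = en] by simp
  moreover have "card (edge_cut en F C) = (\<Sum>e\<in>F. if (en e False \<in> C) \<noteq> (en e True \<in> C) then 1 else 0)"
    unfolding edge_cut_def using assms by (simp add: sum.If_cases Int_def)
  ultimately have "(\<Sum>v\<in>C. deg en F v) + card (edge_cut en F C) =
     (\<Sum>e\<in>F. (if en e False \<in> C then 1 else 0) + (if en e True \<in> C then 1 else 0)
       + (if (en e False \<in> C) \<noteq> (en e True \<in> C) then 1 else 0))"
    by (simp only: sum.distrib)
  moreover have "even \<dots>" by (intro dvd_sum) auto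
  ultimately show ?thesis by simp
qed

section \<open>Factors from fractional factors\<close>

text \<open>The gadget graph: every half-edge becomes a port, the two ports of an edge are joined, and all ports
at a vertex are joined to all its slots. If a vertex has as many slots as half-edges that a factor
must leave out, then factors correspond to perfect matchings, an edge being chosen when its two
ports are matched to each other.\<close>

datatype ('v, 'e) gadget_vertex = Port 'e bool | Slot 'v nat

fun gadget_adj :: "('e \<Rightarrow> bool \<Rightarrow> 'v) \<Rightarrow> ('v, 'e) gadget_vertex \<Rightarrow> ('v, 'e) gadget_vertex \<Rightarrow> bool" where
  "gadget_adj en (Port e b) (Port e' b') \<longleftrightarrow> e = e' \<and> b \<noteq> b'"
| "gadget_adj en (Port e b) (Slot v i) \<longleftrightarrow> en e b = v"
| "gadget_adj en (Slot v i) (Port e b) \<longleftrightarrow> en e b = v"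
| "gadget_adj en (Slot v i) (Slot v' i') \<longleftrightarrow> False"

lemma gadget_adj_sym: "gadget_adj en p q \<longleftrightarrow> gadget_adj en q p"
  by (cases p; cases q) auto

lemma symp_gadget_adj: "symp (gadget_adj en)"
  using gadget_adj_sym by (blast intro: sympI)

text \<open>Weights between 0 and 1 whose sum at each vertex is the prescribed degree, subject to the
inequalities that every actual factor satisfies: if \<open>f(C) + |D|\<close> is odd, the factor cannot meet the
cut of \<open>C\<close> in exactly \<open>D\<close>, so it misses an edge of \<open>D\<close> or contains another edge of the cut.\<close>

locale fractional_factor =
  fixes V :: "'v set" and E :: "'e set" and en :: "'e \<Rightarrow> bool \<Rightarrow> 'v"
    and x :: "'e \<Rightarrow> real" and f :: "'v \<Rightarrow> nat"
  assumes finite_V: "finite V" and finite_E: "finite E"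
    and en_in: "\<And>e b. e \<in> E \<Longrightarrow> en e b \<in> V"
    and x_nonneg: "\<And>e. e \<in> E \<Longrightarrow> 0 \<le> x e"
    and x_le_1: "\<And>e. e \<in> E \<Longrightarrow> x e \<le> 1"
    and x_degree: "\<And>v. v \<in> V \<Longrightarrow> (\<Sum>p\<in>half_edges en E v. x (fst p)) = real (f v)"
    and odd_cut: "\<And>C D. C \<subseteq> V \<Longrightarrow> D \<subseteq> edge_cut en E C \<Longrightarrow> odd ((\<Sum>v\<in>C. f v) + card D) \<Longrightarrow>
      1 \<le> (\<Sum>e\<in>edge_cut en E C - D. x e) + (\<Sum>e\<in>D. 1 - x e)"
begin

definition slots :: "'v \<Rightarrow> nat" where
  "slots v = deg en E v - f v"

definition gadget :: "('v, 'e) gadget_vertex set" where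
  "gadget = (\<lambda>p. Port (fst p) (snd p)) ` (E \<times> UNIV) \<union> (\<lambda>q. Slot (fst q) (snd q)) ` (SIGMA v:V. {..<slots v})"

lemma Port_in_gadget [simp]: "Port e b \<in> gadget \<longleftrightarrow> e \<in> E"
  unfolding gadget_def by force

lemma Slot_in_gadget [simp]: "Slot v i \<in> gadget \<longleftrightarrow> v \<in> V \<and> i < slots v"
  unfolding gadget_def by force

lemma finite_gadget: "finite gadget"
  unfolding gadget_def using finite_V finite_E by auto

lemma sum_gadget:
  fixes g :: "('v, 'e) gadget_vertex \<Rightarrow> 'a::comm_monoid_add"
  shows "(\<Sum>q\<in>gadget. g q) =
    (\<Sum>e\<in>E. g (Port e False) + g (Port e True)) + (\<Sum>v\<in>V. \<Sum>i<slots v. g (Slot v i))"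
proof -
  have "(\<Sum>q\<in>gadget. g q) =
     (\<Sum>q\<in>(\<lambda>p. Port (fst p) (snd p)) ` (E \<times> UNIV). g q)
     + (\<Sum>q\<in>(\<lambda>q. Slot (fst q) (snd q)) ` (SIGMA v:V. {..<slots v}). g q)"
    unfolding gadget_def using finite_V finite_E by (intro sum.union_disjoint) auto
  also have "(\<Sum>q\<in>(\<lambda>p. Port (fst p) (snd p)) ` (E \<times> UNIV). g q) =
      (\<Sum>p\<in>E \<times> UNIV. g (Port (fst p) (snd p)))"
    by (subst sum.reindex) (auto simp: inj_on_def)
  also have "\<dots> = (\<Sum>e\<in>E. g (Port e False) + g (Port e True))"
    using sum_over_ends[OF finite_E, of "\<lambda>e b. g (Port e b)"] .
  also have "(\<Sum>q\<in>(\<lambda>q. Slot (fst q) (snd q)) ` (SIGMA v:V. {..<slots v}). g q) =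
      (\<Sum>p\<in>(SIGMA v:V. {..<slots v}). g (Slot (fst p) (snd p)))"
    by (subst sum.reindex) (auto simp: inj_on_def)
  also have "\<dots> = (\<Sum>v\<in>V. \<Sum>i<slots v. g (Slot v i))"
    using finite_V by (simp add: sum.Sigma case_prod_beta')
  finally show ?thesis .
qed

lemma f_le_deg:
  assumes "v \<in> V"
  shows "f v \<le> deg en E v"
proof -
  have "real (f v) \<le> (\<Sum>p\<in>half_edges en E v. 1)"
    unfolding x_degree[OF assms, symmetric]
    by (rule sum_mono) (auto simp: half_edges_def intro: x_le_1)
  then show ?thesis by (simp add: deg_def)
qed

lemma deficit_sum:
  assumes "v \<in> V"
  shows "(\<Sum>p\<in>half_edges en E v. 1 - x (fst p)) = real (slots v)"
  using f_le_deg[OF assms] x_degree[OF assms]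
  by (simp add: sum_subtractf slots_def deg_def of_nat_diff)

lemma x_eq_1_if_no_slots:
  assumes "e \<in> E" "slots (en e b) = 0"
  shows "x e = 1"
proof -
  have "(\<Sum>p\<in>half_edges en E (en e b). 1 - x (fst p)) = 0"
    using deficit_sum[OF en_in[OF assms(1)]] assms(2) by simp
  moreover have "(\<Sum>p\<in>half_edges en E (en e b). 1 - x (fst p)) = 0 \<longleftrightarrow>
      (\<forall>p\<in>half_edges en E (en e b). 1 - x (fst p) = 0)"
    by (rule sum_nonneg_eq_0_iff) (use finite_E x_le_1 in \<open>auto simp: half_edges_def\<close>)
  moreover have "(e, b) \<in> half_edges en E (en e b)" using assms by (simp add: half_edges_def)
  ultimately show ?thesis by fastforce
qed

text \<open>The cut inequality of the whole vertex set, whose cut is empty, would otherwise read \<open>1 \<le> 0\<close>.\<close>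

lemma even_sum_f: "even (\<Sum>v\<in>V. f v)"
proof -
  have "edge_cut en E V = {}" unfolding edge_cut_def using en_in by auto
  then show ?thesis using odd_cut[of V "{}"] by auto
qed

lemma even_card_gadget: "even (card gadget)"
proof -
  have "card gadget = 2 * card E + (\<Sum>v\<in>V. slots v)"
    using sum_gadget[of "\<lambda>_. 1::nat"] by simp
  moreover have "(\<Sum>v\<in>V. deg en E v) = (\<Sum>v\<in>V. slots v) + (\<Sum>v\<in>V. f v)"
    unfolding sum.distrib[symmetric] slots_def by (intro sum.cong) (use f_le_deg in auto)
  moreover have "edge_cut en E V = {}" unfolding edge_cut_def using en_in by auto
  then have "even (\<Sum>v\<in>V. deg en E v)" using handshake_parity[OF finite_E finite_V, of en] by simp
  ultimately show ?thesis using even_sum_f by simp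
qed

text \<open>At a vertex, the ports of unchosen edges are matched bijectively to its slots; hence the number of
chosen half-edges is the degree minus the number of slots.\<close>

lemma perfect_matching_gives_factor:
  assumes M: "matching gadget (gadget_adj en) M" and perf: "\<Union>M = gadget"
  shows "\<exists>F\<subseteq>E. \<forall>v\<in>V. deg en F v = f v"
proof (intro exI conjI ballI)
  define F where "F = {e \<in> E. {Port e False, Port e True} \<in> M}"
  show FE: "F \<subseteq> E" unfolding F_def by blast
  fix v assume v: "v \<in> V"
  define A where "A = half_edges en (E - F) v"
  have F_iff: "e \<in> F" if "{Port e b, Port e (\<not> b)} \<in> M" "e \<in> E" for e b
    using that unfolding F_def by (cases b) (auto simp: insert_commute)
  have "\<exists>i. i < slots v \<and> {Port (fst p) (snd p), Slot v i} \<in> M" if p: "p \<in> A" for p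
  proof -
    obtain e b where eb: "p = (e, b)" "e \<in> E" "e \<notin> F" "en e b = v"
      using p unfolding A_def half_edges_def by force
    have "Port e b \<in> \<Union>M" using eb perf by simp
    then obtain q where q: "{Port e b, q} \<in> M" "q \<in> gadget" "gadget_adj en (Port e b) q"
      using matching_edge_of[OF M symp_gadget_adj] by metis
    show ?thesis
    proof (cases q)
      case (Port e' b')
      then have "q = Port e (\<not> b)" using q by auto
      then show ?thesis using F_iff[of e b] q eb by simp
    next
      case (Slot v' i)
      then show ?thesis using q eb by auto
    qed
  qed
  then obtain \<phi> where \<phi>: "\<And>p. p \<in> A \<Longrightarrow> \<phi> p < slots v \<and> {Port (fst p) (snd p), Slot v (\<phi> p)} \<in> M"
    by metis
  have "inj_on \<phi> A"
  proof (rule inj_onI)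
    fix p q assume pq: "p \<in> A" "q \<in> A" "\<phi> p = \<phi> q"
    have "{Port (fst p) (snd p), Slot v (\<phi> p)} = {Port (fst q) (snd q), Slot v (\<phi> q)}"
      by (rule matching_edge_unique[OF M, where a = "Slot v (\<phi> p)"]) (use \<phi>[OF pq(1)] \<phi>[OF pq(2)] pq(3) in auto)
    then show "p = q" by (auto simp: doubleton_eq_iff prod_eq_iff)
  qed
  moreover have "\<phi> ` A = {..<slots v}"
  proof
    show "\<phi> ` A \<subseteq> {..<slots v}" using \<phi> by auto
    show "{..<slots v} \<subseteq> \<phi> ` A"
    proof
      fix i assume i: "i \<in> {..<slots v}"
      then have "Slot v i \<in> \<Union>M" using v perf by simp
      then obtain q where q: "{Slot v i, q} \<in> M" "q \<in> gadget" "gadget_adj en (Slot v i) q"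
        using matching_edge_of[OF M symp_gadget_adj] by metis
      then obtain e b where eb: "q = Port e b" "e \<in> E" "en e b = v" by (cases q) auto
      have "e \<notin> F"
      proof
        assume "e \<in> F"
        then have FM: "{Port e False, Port e True} \<in> M" unfolding F_def by simp
        moreover have qM: "{Slot v i, Port e b} \<in> M" using q eb by simp
        moreover have "Port e b \<in> {Port e False, Port e True}" by (cases b) auto
        ultimately have "{Port e False, Port e True} = {Slot v i, Port e b}"
          using matching_edge_unique[OF M FM qM, of "Port e b"] by simp
        then show False by (auto simp: doubleton_eq_iff)
      qed
      then have A: "(e, b) \<in> A" using eb unfolding A_def half_edges_def by simp
      have "{Port e b, Slot v (\<phi> (e, b))} = {Slot v i, Port e b}"
        by (rule matching_edge_unique[OF M, where a = "Port e b"]) (use \<phi>[OF A] q eb in auto)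
      then have "\<phi> (e, b) = i" by (auto simp: doubleton_eq_iff)
      then show "i \<in> \<phi> ` A" using A by blast
    qed
  qed
  ultimately have "card A = slots v" using card_image by fastforce
  moreover have "deg en E v = deg en F v + card A"
  proof -
    have "half_edges en E v = half_edges en F v \<union> A"
      unfolding A_def half_edges_def using FE by auto
    moreover have "half_edges en F v \<inter> A = {}" unfolding A_def half_edges_def by auto
    moreover have "finite (half_edges en F v)" "finite A"
      unfolding A_def using finite_E finite_subset[OF FE finite_E] by auto
    ultimately show ?thesis unfolding deg_def by (simp add: card_Un_disjoint)
  qed
  ultimately show "deg en F v = f v" using f_le_deg[OF v] unfolding slots_def by linarith
qed

text \<open>The given weights extended to a fractional perfect matching of the gadget graph: a port passes what
its edge leaves over in equal shares to the slots of its vertex.\<close>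

fun charge :: "('v, 'e) gadget_vertex \<Rightarrow> ('v, 'e) gadget_vertex \<Rightarrow> real" where
  "charge (Port e b) (Port e' b') = (if e = e' \<and> b \<noteq> b' then x e else 0)"
| "charge (Port e b) (Slot v i) = (if en e b = v then (1 - x e) / slots v else 0)"
| "charge (Slot v i) (Port e b) = (if en e b = v then (1 - x e) / slots v else 0)"
| "charge (Slot v i) (Slot v' i') = 0"

lemma charge_sym: "charge p q = charge q p"
  by (cases p; cases q) auto

lemma charge_nonneg: "p \<in> gadget \<Longrightarrow> q \<in> gadget \<Longrightarrow> 0 \<le> charge p q"
  by (cases p; cases q) (auto intro!: divide_nonneg_nonneg x_nonneg x_le_1 simp: le_diff_eq)

lemma charge_nonadjacent: "\<not> gadget_adj en p q \<Longrightarrow> charge p q = 0"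
  by (cases p; cases q) auto

text \<open>A vertex without slots needs care, since the shares of its ports are quotients by zero; but there
every edge has weight 1 and nothing is left over.\<close>

lemma charge_total:
  assumes "p \<in> gadget"
  shows "(\<Sum>q\<in>gadget. charge p q) = 1"
proof (cases p)
  case (Port e b)
  then have e: "e \<in> E" using assms by simp
  have "(\<Sum>e'\<in>E. charge p (Port e' False) + charge p (Port e' True)) = (\<Sum>e'\<in>E. if e' = e then x e else 0)"
    unfolding Port by (intro sum.cong) (cases b; auto)+
  then have 1: "(\<Sum>e'\<in>E. charge p (Port e' False) + charge p (Port e' True)) = x e"
    using e finite_E by simp
  have "(\<Sum>v\<in>V. \<Sum>i<slots v. charge p (Slot v i)) =
      (\<Sum>v\<in>V. if en e b = v then slots v * ((1 - x e) / slots v) else 0)"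
    unfolding Port by (intro sum.cong) auto
  also have "\<dots> = slots (en e b) * ((1 - x e) / slots (en e b))"
    using finite_V en_in[OF e] by (simp only: sum.delta') simp
  also have "\<dots> = 1 - x e" using x_eq_1_if_no_slots[OF e] by (cases "slots (en e b) = 0") auto
  finally show ?thesis using 1 sum_gadget[of "charge p"] by simp
next
  case (Slot v i)
  then have v: "v \<in> V" "i < slots v" using assms by auto
  have "(\<Sum>e\<in>E. charge p (Port e False) + charge p (Port e True)) =
      (\<Sum>q\<in>half_edges en E v. (1 - x (fst q)) / slots v)"
    unfolding sum_half_edges[OF finite_E, of "\<lambda>e _. (1 - x e) / slots v" en v] Slot by simp
  also have "\<dots> = 1" using deficit_sum[OF v(1)] v(2) by (simp add: sum_divide_distrib[symmetric])
  finally show ?thesis using Slot sum_gadget[of "charge p"] by simp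
qed

text \<open>Now a barrier is assumed whose separating set \<open>U\<close> is spread out in the sense of the minimal barrier
theorem. The aim is to show that each member receives a charge of at least 1 from \<open>U\<close>; as no vertex of
\<open>U\<close> gives away more than 1, the family cannot be larger than \<open>U\<close>.\<close>

context
  fixes U \<C>
  assumes bar: "barrier gadget (gadget_adj en) U \<C>" and cover: "\<Union>\<C> = gadget - U"
    and nonempty: "\<C> \<noteq> {}"
    and spread: "\<And>u C1 C2. u \<in> U \<Longrightarrow> C1 \<in> \<C> \<Longrightarrow> C2 \<in> \<C> \<Longrightarrow>
      \<exists>w\<in>gadget - U. gadget_adj en u w \<and> w \<notin> C1 \<and> w \<notin> C2"
begin

lemma member_of_neighbour:
  assumes "C \<in> \<C>" "p \<in> C" "gadget_adj en p q" "q \<in> gadget" "q \<notin> U"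
  shows "q \<in> C"
  using barrier_closed[OF bar assms(1,2)] assms(3-5) by blast

lemma port_in_barrier:
  assumes "Port e b \<in> U" "C \<in> \<C>"
  shows "\<exists>i<slots (en e b). Slot (en e b) i \<notin> U \<and> Slot (en e b) i \<notin> C"
proof -
  have e: "e \<in> E" using assms(1) barrier_subset[OF bar] by auto
  have "\<exists>C2\<in>\<C>. Port e (\<not> b) \<in> U \<or> Port e (\<not> b) \<in> C2"
    using cover e assms(2) by (cases "Port e (\<not> b) \<in> U") auto
  then obtain C2 where C2: "C2 \<in> \<C>" "Port e (\<not> b) \<in> U \<or> Port e (\<not> b) \<in> C2" by blast
  obtain w where w: "w \<in> gadget - U" "gadget_adj en (Port e b) w" "w \<notin> C" "w \<notin> C2"
    using spread[OF assms C2(1)] by blast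
  show ?thesis
  proof (cases w)
    case (Port e' b')
    then have "w = Port e (\<not> b)" using w(2) by auto
    then show ?thesis using w C2 by auto
  next
    case (Slot v i)
    then show ?thesis using w by auto
  qed
qed

lemma slot_in_barrier:
  assumes "Slot v i \<in> U" "C \<in> \<C>"
  shows "\<exists>e b. e \<in> E \<and> en e b = v \<and> Port e b \<notin> U \<and> Port e b \<notin> C"
proof -
  obtain w where "w \<in> gadget - U" "gadget_adj en (Slot v i) w" "w \<notin> C"
    using spread[OF assms(1,2,2)] by blast
  then show ?thesis by (cases w) auto
qed

text \<open>If neither the ports nor the slots of \<open>v\<close> all lie in \<open>U\<close>, then the ports and slots outside \<open>U\<close> lie in
one member, as they form a complete bipartite graph. Anything of \<open>v\<close> inside \<open>U\<close> would then reach
at most two members: this one and, for a port, the one of the other port of its edge.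
So the gadget of \<open>v\<close> avoids \<open>U\<close> altogether.\<close>

lemma gadget_in_one_component:
  assumes C: "C \<in> \<C>" and e: "e \<in> E" "en e b = v" "Port e b \<notin> U"
    and i: "i < slots v" "Slot v i \<notin> U" and pC: "Port e b \<in> C \<or> Slot v i \<in> C"
  shows "\<And>e' b'. e' \<in> E \<Longrightarrow> en e' b' = v \<Longrightarrow> Port e' b' \<in> C"
    and "\<And>j. j < slots v \<Longrightarrow> Slot v j \<in> C"
proof -
  have v: "v \<in> V" using en_in e by blast
  have both: "Port e b \<in> C" "Slot v i \<in> C"
    using member_of_neighbour[OF C, of "Port e b" "Slot v i"]
      member_of_neighbour[OF C, of "Slot v i" "Port e b"] pC e i v by auto
  have port: "Port e' b' \<in> C" if "e' \<in> E" "en e' b' = v" "Port e' b' \<notin> U" for e' b'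
    using member_of_neighbour[OF C both(2), of "Port e' b'"] that by simp
  have slot: "Slot v j \<in> C" if "j < slots v" "Slot v j \<notin> U" for j
    using member_of_neighbour[OF C both(1), of "Slot v j"] that e v by simp
  show "Port e' b' \<in> C" if "e' \<in> E" "en e' b' = v" for e' b'
    using port[OF that] port_in_barrier[of e' b', OF _ C] slot that(2) by blast
  show "Slot v j \<in> C" if "j < slots v" for j
    using slot[OF that] slot_in_barrier[of v j, OF _ C] port by blast
qed

text \<open>If some element of \<open>C\<close> has all its neighbours in \<open>U\<close>, its total charge 1 comes from \<open>U\<close>. Otherwise
let \<open>K\<close> be the set of vertices whose gadgets lie in \<open>C\<close>, and \<open>D\<close> the set of edges leaving \<open>K\<close> that
have both ports in \<open>C\<close>. Counting the elements of \<open>C\<close> modulo 2 turns the oddness of \<open>C\<close> into that of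
\<open>f(K) + |D|\<close>, and the cut inequality for \<open>K\<close> and \<open>D\<close> bounds the charge: for an edge of \<open>D\<close>, the end
outside \<open>K\<close> has all its slots in \<open>U\<close>, and they send \<open>1 - x e\<close> to the port there; any other edge leaving
\<open>K\<close> has its outer port in \<open>U\<close>, which sends \<open>x e\<close> across the edge.\<close>

lemma component_charge:
  assumes C: "C \<in> \<C>"
  shows "1 \<le> (\<Sum>c\<in>C. \<Sum>u\<in>U. charge c u)"
proof -
  have Csub: "C \<subseteq> gadget" "C \<inter> U = {}" and oddC: "odd (card C)"
    using barrier_member[OF bar C] by auto
  have Usub: "U \<subseteq> gadget" using barrier_subset[OF bar] .
  have finC: "finite C" and finU: "finite U" using Csub(1) Usub finite_gadget by (meson finite_subset)+
  define t where "t p = (\<Sum>u\<in>U. charge p u)" for p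
  have t_nonneg: "0 \<le> t p" if "p \<in> gadget" for p
    unfolding t_def using charge_nonneg[OF that] Usub by (auto intro!: sum_nonneg)
  have t_ge: "charge p u \<le> t p" if "p \<in> gadget" "u \<in> U" for p u
    unfolding t_def using charge_nonneg[OF that(1)] Usub finU that(2) by (intro member_le_sum) auto
  have t_compl: "t p + (\<Sum>q\<in>gadget - U. charge p q) = 1" if "p \<in> gadget" for p
    using charge_total[OF that] sum.subset_diff[OF Usub finite_gadget, of "charge p"] unfolding t_def by simp
  show ?thesis
  proof (cases "\<exists>p\<in>C. \<forall>q\<in>gadget - U. \<not> gadget_adj en p q")
    case True
    then obtain p where p: "p \<in> C" "\<forall>q\<in>gadget - U. \<not> gadget_adj en p q" by blast
    have "(\<Sum>q\<in>gadget - U. charge p q) = 0" using p(2) by (intro sum.neutral) (auto simp: charge_nonadjacent)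
    then have "t p = 1" using t_compl[of p] p Csub by auto
    moreover have "t p \<le> (\<Sum>c\<in>C. t c)" using p finC t_nonneg Csub by (intro member_le_sum) auto
    ultimately show ?thesis unfolding t_def by simp
  next
    case False
    have nbr: "\<exists>q\<in>C. gadget_adj en p q" if p: "p \<in> C" for p
    proof -
      obtain q where "q \<in> gadget - U" "gadget_adj en p q" using False p by blast
      then show ?thesis using member_of_neighbour[OF C p] by blast
    qed
    have in_U: "q \<in> U" if "p \<in> C" "gadget_adj en p q" "q \<in> gadget" "q \<notin> C" for p q
      using member_of_neighbour[OF C that(1-3)] that(4) by blast
    define K where "K = {v \<in> V. \<exists>i<slots v. Slot v i \<in> C}"
    have K_sub: "K \<subseteq> V" unfolding K_def by blast
    have K_all: "e \<in> E \<Longrightarrow> en e b = v \<Longrightarrow> Port e b \<in> C" "i < slots v \<Longrightarrow> Slot v i \<in> C"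
      if v: "v \<in> K" for v e b i
    proof -
      obtain j where j: "j < slots v" "Slot v j \<in> C" using v unfolding K_def by blast
      obtain q where q: "q \<in> C" "gadget_adj en (Slot v j) q" using nbr[OF j(2)] by blast
      then obtain e0 b0 where p: "q = Port e0 b0" "en e0 b0 = v" by (cases q) auto
      have a: "e0 \<in> E" "Port e0 b0 \<notin> U" "Slot v j \<notin> U" using q(1) j(2) p Csub by auto
      note g = gadget_in_one_component[OF C a(1) p(2) a(2) j(1) a(3) disjI2[OF j(2)]]
      show "e \<in> E \<Longrightarrow> en e b = v \<Longrightarrow> Port e b \<in> C" "i < slots v \<Longrightarrow> Slot v i \<in> C"
        using g by auto
    qed
    have outside: "Slot (en e b) i \<in> U" if "Port e b \<in> C" "en e b \<notin> K" "i < slots (en e b)" for e b i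
      using in_U[OF that(1), of "Slot (en e b) i"] that Csub en_in unfolding K_def by auto
    have mate: "Port e (\<not> b) \<in> C" if p: "Port e b \<in> C" "en e b \<notin> K" for e b
    proof -
      obtain q where q: "q \<in> C" "gadget_adj en (Port e b) q" using nbr[OF p(1)] by blast
      show ?thesis
      proof (cases q)
        case (Port e' b')
        then have "q = Port e (\<not> b)" using q(2) by auto
        then show ?thesis using q by simp
      next
        case (Slot v i)
        then show ?thesis using q p Csub unfolding K_def by auto
      qed
    qed
    define D where "D = {e \<in> edge_cut en E K. Port e False \<in> C \<and> Port e True \<in> C}"
    have D_sub: "D \<subseteq> edge_cut en E K" unfolding D_def by blast
    have cutE: "edge_cut en E K \<subseteq> E" unfolding edge_cut_def by blast
    have one_port: "e \<in> edge_cut en E K - D \<longleftrightarrow> (Port e False \<in> C) \<noteq> (Port e True \<in> C)" if e: "e \<in> E" for e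
    proof
      assume "e \<in> edge_cut en E K - D"
      then have "(en e False \<in> K) \<noteq> (en e True \<in> K)" "\<not> (Port e False \<in> C \<and> Port e True \<in> C)"
        unfolding D_def edge_cut_def by auto
      then show "(Port e False \<in> C) \<noteq> (Port e True \<in> C)" using K_all(1)[OF _ e refl] by blast
    next
      assume one: "(Port e False \<in> C) \<noteq> (Port e True \<in> C)"
      then have "(en e False \<in> K) \<noteq> (en e True \<in> K)"
        using K_all(1)[OF _ e refl] mate[of e False] mate[of e True] by auto
      then show "e \<in> edge_cut en E K - D" using one e unfolding D_def edge_cut_def by auto
    qed
    have "even (card C + (\<Sum>v\<in>K. slots v) + card (edge_cut en E K - D))"
    proof -
      have "card C = (\<Sum>q\<in>gadget. if q \<in> C then 1 else 0)"
        using Csub finite_gadget by (simp add: sum.If_cases Int_absorb1)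
      also have "\<dots> = (\<Sum>e\<in>E. (if Port e False \<in> C then 1 else 0) + (if Port e True \<in> C then 1 else 0))
          + (\<Sum>v\<in>V. \<Sum>i<slots v. if Slot v i \<in> C then 1 else 0)"
        by (rule sum_gadget)
      also have "(\<Sum>v\<in>V. \<Sum>i<slots v. if Slot v i \<in> C then 1 else 0) = (\<Sum>v\<in>V. if v \<in> K then slots v else 0)"
      proof (rule sum.cong[OF refl])
        fix v assume v: "v \<in> V"
        have "(\<Sum>i<slots v. if Slot v i \<in> C then 1 else 0) = (\<Sum>i<slots v. if v \<in> K then 1 else 0 :: nat)"
          by (rule sum.cong[OF refl]) (use K_all(2)[of v] v in \<open>auto simp: K_def\<close>)
        then show "(\<Sum>i<slots v. if Slot v i \<in> C then 1 else 0) = (if v \<in> K then slots v else 0)" by simp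
      qed
      also have "\<dots> = (\<Sum>v\<in>K. slots v)"
        using K_sub finite_V by (simp add: sum.If_cases Int_absorb1)
      finally have 1: "card C = (\<Sum>e\<in>E. (if Port e False \<in> C then 1 else 0) + (if Port e True \<in> C then 1 else 0))
          + (\<Sum>v\<in>K. slots v)" .
      have 2: "card (edge_cut en E K - D) = (\<Sum>e\<in>E. if (Port e False \<in> C) \<noteq> (Port e True \<in> C) then 1 else 0)"
      proof -
        have "edge_cut en E K - D = {e \<in> E. (Port e False \<in> C) \<noteq> (Port e True \<in> C)}"
          using one_port cutE by blast
        then show ?thesis using finite_E by (simp add: sum.If_cases Int_def)
      qed
      have "even (\<Sum>e\<in>E. ((if Port e False \<in> C then 1 else 0) + (if Port e True \<in> C then 1 else 0))
          + (if (Port e False \<in> C) \<noteq> (Port e True \<in> C) then 1 else (0::nat)))"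
        by (intro dvd_sum) auto
      then show ?thesis unfolding 1 2 by (simp only: sum.distrib) presburger
    qed
    moreover have "(\<Sum>v\<in>K. deg en E v) = (\<Sum>v\<in>K. slots v) + (\<Sum>v\<in>K. f v)"
      unfolding sum.distrib[symmetric] slots_def
      by (intro sum.cong) (use f_le_deg K_sub in auto)
    moreover have "even ((\<Sum>v\<in>K. deg en E v) + card (edge_cut en E K))"
      using handshake_parity[OF finite_E] K_sub finite_V finite_subset by blast
    moreover have "card (edge_cut en E K) = card (edge_cut en E K - D) + card D"
      using D_sub finite_E by (metis card_Diff_subset card_mono finite_edge_cut finite_subset le_add_diff_inverse2)
    ultimately have "even (card C + (\<Sum>v\<in>K. slots v) + card (edge_cut en E K - D))"
        and "even ((\<Sum>v\<in>K. slots v) + (\<Sum>v\<in>K. f v) + (card (edge_cut en E K - D) + card D))"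
      by simp_all
    then have "odd ((\<Sum>v\<in>K. f v) + card D)" using oddC by (simp only: even_add) blast
    from odd_cut[OF K_sub D_sub this]
    have ineq: "1 \<le> (\<Sum>e\<in>edge_cut en E K - D. x e) + (\<Sum>e\<in>D. 1 - x e)" .
    \<comment> \<open>The end of a cut edge whose port is charged: the end in \<open>K\<close>, but for edges of \<open>D\<close> the other one.\<close>
    define side where "side e = ((en e True \<in> K) = (e \<notin> D))" for e
    have side: "Port e (side e) \<in> C \<and> (if e \<in> D then 1 - x e else x e) \<le> t (Port e (side e))"
      if e: "e \<in> edge_cut en E K" for e
    proof (cases "e \<in> D")
      case True
      have eE: "e \<in> E" using e cutE by blast
      have inC: "Port e (side e) \<in> C" "Port e (\<not> side e) \<in> C"
        using True unfolding D_def by (cases "side e"; auto)+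
      have notK: "en e (side e) \<notin> K"
        using True e unfolding side_def edge_cut_def by (cases "en e True \<in> K") auto
      have "(\<Sum>q\<in>gadget - U. charge (Port e (side e)) q) = (\<Sum>q\<in>{Port e (\<not> side e)}. charge (Port e (side e)) q)"
      proof (rule sum.mono_neutral_right)
        show "finite (gadget - U)" using finite_gadget by simp
        show "{Port e (\<not> side e)} \<subseteq> gadget - U" using inC Csub by auto
        show "\<forall>q\<in>gadget - U - {Port e (\<not> side e)}. charge (Port e (side e)) q = 0"
        proof
          fix q assume q: "q \<in> gadget - U - {Port e (\<not> side e)}"
          then show "charge (Port e (side e)) q = 0"
            using outside[OF inC(1) notK] by (cases q) auto
        qed
      qed
      then have "t (Port e (side e)) = 1 - x e" using t_compl[of "Port e (side e)"] eE by simp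
      then show ?thesis using inC True by simp
    next
      case False
      have eE: "e \<in> E" using e cutE by blast
      have "en e (side e) \<in> K" using False e unfolding side_def edge_cut_def by (cases "en e True \<in> K") auto
      then have inC: "Port e (side e) \<in> C" using K_all(1)[OF _ eE] by blast
      have "Port e (\<not> side e) \<notin> C" using inC False e unfolding D_def by (cases "side e") auto
      then have "Port e (\<not> side e) \<in> U" using in_U[OF inC, of "Port e (\<not> side e)"] eE by simp
      then have "charge (Port e (side e)) (Port e (\<not> side e)) \<le> t (Port e (side e))"
        using t_ge[of "Port e (side e)" "Port e (\<not> side e)"] eE by simp
      then show ?thesis using inC False by simp
    qed
    have "(\<Sum>e\<in>edge_cut en E K - D. x e) + (\<Sum>e\<in>D. 1 - x e) = (\<Sum>e\<in>edge_cut en E K. if e \<in> D then 1 - x e else x e)"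
      using D_sub finite_E sum.subset_diff[OF D_sub, of "\<lambda>e. if e \<in> D then 1 - x e else x e"] by simp
    also have "\<dots> \<le> (\<Sum>e\<in>edge_cut en E K. t (Port e (side e)))" using side by (intro sum_mono) blast
    also have "\<dots> = (\<Sum>p\<in>(\<lambda>e. Port e (side e)) ` edge_cut en E K. t p)"
      by (subst sum.reindex) (auto simp: inj_on_def)
    also have "\<dots> \<le> (\<Sum>c\<in>C. t c)"
      by (rule sum_mono2) (use finC side t_nonneg Csub in auto)
    finally show ?thesis using ineq unfolding t_def by simp
  qed
qed

lemma card_components_le: "card \<C> \<le> card U"
proof -
  have finU: "finite U" "finite \<C>" using barrier_finite[OF finite_gadget bar] by auto
  have Usub: "U \<subseteq> gadget" using barrier_subset[OF bar] .
  have "real (card \<C>) = (\<Sum>C\<in>\<C>. 1)" by simp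
  also have "\<dots> \<le> (\<Sum>C\<in>\<C>. \<Sum>c\<in>C. \<Sum>u\<in>U. charge c u)"
    by (rule sum_mono) (rule component_charge)
  also have "\<dots> = (\<Sum>c\<in>gadget - U. \<Sum>u\<in>U. charge c u)"
  proof -
    have "\<forall>C\<in>\<C>. finite C" using barrier_member(1)[OF bar] finite_gadget by (meson finite_Diff finite_subset)
    moreover have "\<forall>A\<in>\<C>. \<forall>B\<in>\<C>. A \<noteq> B \<longrightarrow> A \<inter> B = {}" using barrier_disjoint[OF bar] by blast
    ultimately show ?thesis using sum.Union_disjoint[of \<C> "\<lambda>c. \<Sum>u\<in>U. charge c u"] cover by simp
  qed
  also have "\<dots> = (\<Sum>u\<in>U. \<Sum>c\<in>gadget - U. charge u c)"
    by (subst sum.swap) (simp add: charge_sym)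
  also have "\<dots> \<le> (\<Sum>u\<in>U. 1)"
  proof (rule sum_mono)
    fix u assume u: "u \<in> U"
    then have "(\<Sum>c\<in>gadget - U. charge u c) \<le> (\<Sum>c\<in>gadget. charge u c)"
      using Usub charge_nonneg[of u] finite_gadget by (intro sum_mono2) auto
    then show "(\<Sum>c\<in>gadget - U. charge u c) \<le> 1" using charge_total[of u] u Usub by auto
  qed
  finally show ?thesis by simp
qed

end

text \<open>Without a perfect matching, a minimal barrier of the gadget graph would have more members than
separating vertices, which the charges forbid.\<close>

theorem factor_exists: "\<exists>F\<subseteq>E. \<forall>v\<in>V. deg en F v = f v"
proof (rule ccontr)
  assume no: "\<not> ?thesis"
  have "\<Union>M \<noteq> gadget" if "matching gadget (gadget_adj en) M" for M
    using perfect_matching_gives_factor[OF that] no by blast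
  then obtain U \<C> where b: "barrier gadget (gadget_adj en) U \<C>" "\<Union>\<C> = gadget - U" "card U < card \<C>"
    "\<And>u C1 C2. u \<in> U \<Longrightarrow> C1 \<in> \<C> \<Longrightarrow> C2 \<in> \<C> \<Longrightarrow>
      \<exists>w\<in>gadget - U. gadget_adj en u w \<and> w \<notin> C1 \<and> w \<notin> C2"
    using tutte_minimal_barrier[OF finite_gadget symp_gadget_adj even_card_gadget, of en] by blast
  then have "\<C> \<noteq> {}" by auto
  from card_components_le[OF b(1,2) this b(4)] show False using b(3) by simp
qed

end

section \<open>Rounding real flows\<close>

text \<open>In a bipartite graph the cut inequalities hold by themselves. Give the half-edges opposite signs on the
two sides and add up the weights at the vertices of \<open>C\<close>: the result is an integer of the parity of \<open>f(C)\<close>,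
and edges inside \<open>C\<close> cancel. Subtracting the signs of the edges of \<open>D\<close> leaves an odd integer, whose
absolute value is at least 1 and at most the left-hand side of the inequality.\<close>

lemma bipartite_factor:
  fixes V :: "'v set" and E :: "'e set" and en :: "'e \<Rightarrow> bool \<Rightarrow> 'v"
    and x :: "'e \<Rightarrow> real" and f :: "'v \<Rightarrow> nat"
  assumes fin: "finite V" "finite E" and en_in: "\<And>e b. e \<in> E \<Longrightarrow> en e b \<in> V"
    and x: "\<And>e. e \<in> E \<Longrightarrow> 0 \<le> x e" "\<And>e. e \<in> E \<Longrightarrow> x e \<le> 1"
    and degree: "\<And>v. v \<in> V \<Longrightarrow> (\<Sum>p\<in>half_edges en E v. x (fst p)) = real (f v)"
    and bip: "\<And>e. e \<in> E \<Longrightarrow> en e False \<in> X \<and> en e True \<notin> X"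
  shows "\<exists>F\<subseteq>E. \<forall>v\<in>V. deg en F v = f v"
proof -
  have "fractional_factor V E en x f"
  proof
    fix C D assume C: "C \<subseteq> V" and D: "D \<subseteq> edge_cut en E C" and odd: "odd ((\<Sum>v\<in>C. f v) + card D)"
    have finC: "finite C" and finD: "finite D"
      using C D fin finite_subset finite_edge_cut by blast+
    define s :: "'v \<Rightarrow> int" where "s v = (if v \<in> X then 1 else -1)" for v
    define \<sigma> :: "'e \<Rightarrow> int" where "\<sigma> e = (if en e False \<in> C then 1 else -1)" for e
    define N where "N = (\<Sum>v\<in>C. s v * int (f v))"
    have "real_of_int N = (\<Sum>v\<in>C. \<Sum>p\<in>half_edges en E v. s v * x (fst p))"
      unfolding N_def of_int_sum using degree C
      by (intro sum.cong refl) (auto simp: sum_distrib_left[symmetric])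
    also have "\<dots> = (\<Sum>v\<in>C. \<Sum>p\<in>half_edges en E v. s (en (fst p) (snd p)) * x (fst p))"
      by (intro sum.cong refl) (auto simp: half_edges_def)
    also have "\<dots> = (\<Sum>e\<in>E. (if en e False \<in> C then s (en e False) * x e else 0)
        + (if en e True \<in> C then s (en e True) * x e else 0))"
      using sum_sum_half_edges[OF fin(2) finC, where g = "\<lambda>e b. s (en e b) * x e" and en = en] .
    also have "\<dots> = (\<Sum>e\<in>E. if (en e False \<in> C) \<noteq> (en e True \<in> C) then \<sigma> e * x e else 0)"
      using bip by (intro sum.cong refl) (auto simp: s_def \<sigma>_def)
    also have "\<dots> = (\<Sum>e\<in>edge_cut en E C. \<sigma> e * x e)"
      unfolding edge_cut_def using fin(2) by (rule sum.inter_filter[symmetric])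
    finally have N: "real_of_int N = (\<Sum>e\<in>edge_cut en E C - D. \<sigma> e * x e) + (\<Sum>e\<in>D. \<sigma> e * x e)"
      using sum.subset_diff[OF D] fin by simp
    have "even (N - (\<Sum>v\<in>C. int (f v)))"
      unfolding N_def sum_subtractf[symmetric] by (intro dvd_sum) (auto simp: s_def)
    moreover have "even ((\<Sum>e\<in>D. \<sigma> e) - (\<Sum>e\<in>D. 1))"
      unfolding sum_subtractf[symmetric] by (intro dvd_sum) (auto simp: \<sigma>_def)
    moreover have "odd ((\<Sum>v\<in>C. int (f v)) + (\<Sum>e\<in>D. 1))"
    proof -
      have "(\<Sum>v\<in>C. int (f v)) + (\<Sum>e\<in>D. 1) = int ((\<Sum>v\<in>C. f v) + card D)" by simp
      then show ?thesis using odd by presburger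
    qed
    ultimately have "odd (N - (\<Sum>e\<in>D. \<sigma> e))" by (simp only: even_add even_diff) blast
    then have "N - (\<Sum>e\<in>D. \<sigma> e) \<noteq> 0" by (metis even_zero)
    then have "1 \<le> \<bar>N - (\<Sum>e\<in>D. \<sigma> e)\<bar>" by linarith
    then have "1 \<le> \<bar>real_of_int (N - (\<Sum>e\<in>D. \<sigma> e))\<bar>" by linarith
    also have "real_of_int (N - (\<Sum>e\<in>D. \<sigma> e)) = (\<Sum>e\<in>edge_cut en E C - D. \<sigma> e * x e) + (\<Sum>e\<in>D. \<sigma> e * (x e - 1))"
      unfolding of_int_diff N by (simp add: right_diff_distrib sum_subtractf)
    also have "\<bar>\<dots>\<bar> \<le> (\<Sum>e\<in>edge_cut en E C - D. \<bar>\<sigma> e * x e\<bar>) + (\<Sum>e\<in>D. \<bar>\<sigma> e * (x e - 1)\<bar>)"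
      by (rule order_trans[OF abs_triangle_ineq]) (intro add_mono sum_abs)
    also have "\<dots> = (\<Sum>e\<in>edge_cut en E C - D. x e) + (\<Sum>e\<in>D. 1 - x e)"
    proof -
      have "edge_cut en E C \<subseteq> E" unfolding edge_cut_def by blast
      then show ?thesis using D x
        by (intro arg_cong2[of _ _ _ _ "(+)"] sum.cong refl) (auto simp: \<sigma>_def subset_iff)
    qed
    finally show "1 \<le> (\<Sum>e\<in>edge_cut en E C - D. x e) + (\<Sum>e\<in>D. 1 - x e)" .
  qed (use assms in auto)
  then show ?thesis by (rule fractional_factor.factor_exists)
qed

text \<open>The net outflow at \<open>p\<close> of a flow \<open>y\<close>; a loop contributes nothing.\<close>

definition excess :: "('a \<Rightarrow> bool \<Rightarrow> 'n) \<Rightarrow> 'a set \<Rightarrow> ('a \<Rightarrow> 'r::ab_group_add) \<Rightarrow> 'n \<Rightarrow> 'r" where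
  "excess en A y p = (\<Sum>a\<in>A. (if en a False = p then y a else 0) - (if en a True = p then y a else 0))"

lemma excess_of_int: "excess en A (\<lambda>a. real_of_int (y a)) p = real_of_int (excess en A y p)"
  unfolding excess_def of_int_sum by (intro sum.cong) auto

lemma excess_add: "excess en A (\<lambda>a. y a + z a) p = excess en A y p + excess en A z p"
  unfolding excess_def sum.distrib[symmetric] by (intro sum.cong) auto

text \<open>Each arc with a fractional value becomes a node that chooses exactly one of its two ends: its tail if
the value is rounded up, its head if it is rounded down. Preserving the excess at a node of the
network then means that a prescribed number of arcs chooses it, so a rounding is a factor of the
bipartite graph of arcs and nodes, and the fractional parts are a fractional factor.\<close>

lemma round_integral_excess:
  fixes en :: "'a \<Rightarrow> bool \<Rightarrow> 'n" and x :: "'a \<Rightarrow> real"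
  assumes fin: "finite A" and int: "\<And>p. excess en A x p \<in> \<int>"
  shows "\<exists>y :: 'a \<Rightarrow> int. (\<forall>a\<in>A. \<bar>real_of_int (y a) - x a\<bar> < 1) \<and>
    (\<forall>p. real_of_int (excess en A y p) = excess en A x p)"
proof -
  \<comment> \<open>Integral arcs stay out of the bipartite graph: a factor need not respect weights 0 and 1.\<close>
  define B where "B = {a \<in> A. x a \<notin> \<int>}"
  have finB: "finite B" and BA: "B \<subseteq> A" using fin unfolding B_def by auto
  have frac_sum: "excess en B (\<lambda>a. frac (x a)) p = excess en A x p - real_of_int (excess en A (\<lambda>a. \<lfloor>x a\<rfloor>) p)" for p
  proof -
    have "excess en A x p - real_of_int (excess en A (\<lambda>a. \<lfloor>x a\<rfloor>) p) = excess en A (\<lambda>a. frac (x a)) p"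
      unfolding excess_of_int[symmetric] unfolding excess_def sum_subtractf[symmetric]
      by (intro sum.cong) (auto simp: frac_def)
    also have "\<dots> = excess en B (\<lambda>a. frac (x a)) p"
      unfolding excess_def using fin BA
      by (intro sum.mono_neutral_right) (auto simp: B_def frac_eq_0_iff)
    finally show ?thesis by simp
  qed
  define V where "V = Inl ` (\<lambda>p. en (fst p) (snd p)) ` (B \<times> UNIV) \<union> Inr ` B"
  define E where "E = B \<times> (UNIV :: bool set)"
  define en' where "en' e b = (if b then Inr (fst e) else Inl (en (fst e) (snd e)))" for e :: "'a \<times> bool" and b
  define x' where "x' e = (if snd e then 1 - frac (x (fst e)) else frac (x (fst e)))" for e :: "'a \<times> bool"
  have end_sum: "(\<Sum>q\<in>half_edges en' E' (Inl p). g (fst q)) =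
      (\<Sum>a\<in>B. (if en a False = p \<and> (a, False) \<in> E' then g (a, False) else 0)
        + (if en a True = p \<and> (a, True) \<in> E' then g (a, True) else 0))"
    if "E' \<subseteq> E" for g :: "'a \<times> bool \<Rightarrow> real" and p E'
  proof -
    have finE': "finite E'" using that finB unfolding E_def by (auto intro: finite_subset)
    have "(\<Sum>q\<in>half_edges en' E' (Inl p). g (fst q)) = (\<Sum>e\<in>E'. if en (fst e) (snd e) = p then g e else 0)"
      using sum_half_edges[OF finE', of "\<lambda>e _. g e" en' "Inl p"] by (simp add: en'_def)
    also have "\<dots> = (\<Sum>e\<in>E. if en (fst e) (snd e) = p \<and> e \<in> E' then g e else 0)"
      using that finB unfolding E_def by (intro sum.mono_neutral_cong_left) auto
    also have "\<dots> = (\<Sum>a\<in>B. (if en a False = p \<and> (a, False) \<in> E' then g (a, False) else 0)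
        + (if en a True = p \<and> (a, True) \<in> E' then g (a, True) else 0))"
      unfolding E_def
      using sum_over_ends[OF finB, of "\<lambda>a b. if en a b = p \<and> (a, b) \<in> E' then g (a, b) else 0"]
      by (simp only: prod.collapse)
    finally show ?thesis .
  qed
  have arc_sum: "(\<Sum>q\<in>half_edges en' E' (Inr a). g (fst q)) =
      (if (a, False) \<in> E' then g (a, False) else 0) + (if (a, True) \<in> E' then g (a, True) else 0)"
    if "E' \<subseteq> E" for g :: "'a \<times> bool \<Rightarrow> real" and a E'
  proof -
    have finE': "finite E'" using that finB unfolding E_def by (auto intro: finite_subset)
    have "(\<Sum>q\<in>half_edges en' E' (Inr a). g (fst q)) = (\<Sum>e\<in>E'. if fst e = a then g e else 0)"
      using sum_half_edges[OF finE', of "\<lambda>e _. g e" en' "Inr a"] by (simp add: en'_def)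
    also have "\<dots> = (\<Sum>e\<in>{(a, False), (a, True)}. if e \<in> E' then g e else 0)"
    proof (rule sum.mono_neutral_cong)
      show "(if fst i = a then g i else 0) = 0" if "i \<in> E' - {(a, False), (a, True)}" for i
        using that by (cases i; cases "snd i") auto
    qed (use finE' in auto)
    finally show ?thesis by simp
  qed
  define h where "h p = (\<Sum>q\<in>half_edges en' E (Inl p). x' (fst q))" for p
  have h_eq: "h p = excess en B (\<lambda>a. frac (x a)) p + (\<Sum>a\<in>B. if en a True = p then 1 else 0)" for p
    unfolding h_def end_sum[OF order_refl] excess_def sum.distrib[symmetric]
    by (intro sum.cong) (auto simp: x'_def E_def)
  have "h p \<in> \<int>" for p unfolding h_eq frac_sum
    by (intro Ints_add Ints_diff int Ints_of_int Ints_sum) auto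
  moreover have "h p \<ge> 0" for p unfolding h_def
    by (intro sum_nonneg) (auto simp: x'_def frac_lt_1 less_imp_le)
  ultimately have h_nat: "real (nat \<lfloor>h p\<rfloor>) = h p" for p
    by (metis Ints_cases floor_of_int of_int_0_le_iff of_nat_nat)
  define f where "f v = (case v of Inl p \<Rightarrow> nat \<lfloor>h p\<rfloor> | Inr a \<Rightarrow> 1)" for v :: "'n + 'a"
  have "\<exists>F\<subseteq>E. \<forall>v\<in>V. deg en' F v = f v"
  proof (rule bipartite_factor[where x = x' and X = "range Inl"])
    show "finite V" "finite E" using finB unfolding V_def E_def by auto
    show "en' e b \<in> V" if "e \<in> E" for e b
      using that unfolding V_def E_def en'_def by (auto intro!: imageI)
    show "0 \<le> x' e" "x' e \<le> 1" for e unfolding x'_def by (auto simp: frac_lt_1 less_imp_le)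
    show "(\<Sum>p\<in>half_edges en' E v. x' (fst p)) = real (f v)" if "v \<in> V" for v
    proof (cases v)
      case (Inl p)
      then show ?thesis using h_nat[of p] unfolding h_def f_def by simp
    next
      case (Inr a)
      then have "a \<in> B" using that unfolding V_def by auto
      then show ?thesis unfolding Inr arc_sum[OF order_refl] f_def by (simp add: E_def x'_def)
    qed
    show "en' e False \<in> range Inl \<and> en' e True \<notin> range Inl" for e unfolding en'_def by auto
  qed
  then obtain F where F: "F \<subseteq> E" "\<And>v. v \<in> V \<Longrightarrow> deg en' F v = f v" by blast
  have deg_sum: "real (deg en' F v) = (\<Sum>q\<in>half_edges en' F v. 1)" for v by (simp add: deg_def)
  have one: "(a, True) \<in> F \<longleftrightarrow> (a, False) \<notin> F" if "a \<in> B" for a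
  proof -
    have "real (deg en' F (Inr a)) = 1" using F(2)[of "Inr a"] that unfolding V_def f_def by simp
    then show ?thesis unfolding deg_sum arc_sum[OF F(1), where g = "\<lambda>_. 1"] by (auto split: if_splits)
  qed
  define u :: "'a \<Rightarrow> int" where "u a = (if (a, False) \<in> F then 1 else 0)" for a
  have u_excess: "excess en B (\<lambda>a. real_of_int (u a)) p = excess en B (\<lambda>a. frac (x a)) p" for p
  proof (cases "Inl p \<in> V")
    case True
    have "excess en B (\<lambda>a. real_of_int (u a)) p + (\<Sum>a\<in>B. if en a True = p then 1 else 0) = real (deg en' F (Inl p))"
      unfolding deg_sum end_sum[OF F(1), where g = "\<lambda>_. 1"] excess_def sum.distrib[symmetric]
      by (intro sum.cong) (auto simp: u_def one)
    also have "\<dots> = h p" using F(2)[OF True] h_nat unfolding f_def by simp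
    finally show ?thesis unfolding h_eq by simp
  next
    case False
    then have "en a b \<noteq> p" if "a \<in> B" for a b using that unfolding V_def by force
    then show ?thesis unfolding excess_def by simp
  qed
  define y where "y a = \<lfloor>x a\<rfloor> + (if a \<in> B then u a else 0)" for a
  have "\<bar>real_of_int (y a) - x a\<bar> < 1" if "a \<in> A" for a
  proof (cases "a \<in> B")
    case True
    then have "frac (x a) \<noteq> 0" unfolding B_def by (simp add: frac_eq_0_iff)
    then have "0 < frac (x a)" using frac_ge_0[of "x a"] by linarith
    then show ?thesis using True frac_lt_1[of "x a"] unfolding y_def u_def frac_def by auto
  next
    case False
    then show ?thesis unfolding y_def by simp linarith
  qed
  moreover have "real_of_int (excess en A y p) = excess en A x p" for p
  proof -
    have "real_of_int (excess en A y p) = excess en A (\<lambda>a. real_of_int \<lfloor>x a\<rfloor>) p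
        + excess en A (\<lambda>a. real_of_int (if a \<in> B then u a else 0)) p"
      unfolding excess_of_int[symmetric] y_def of_int_add by (rule excess_add)
    also have "excess en A (\<lambda>a. real_of_int (if a \<in> B then u a else 0)) p = excess en B (\<lambda>a. real_of_int (u a)) p"
      unfolding excess_def using fin BA by (intro sum.mono_neutral_cong_right) auto
    also have "\<dots> = excess en A x p - excess en A (\<lambda>a. real_of_int \<lfloor>x a\<rfloor>) p"
      using u_excess[of p] frac_sum[of p] by (simp only: excess_of_int)
    finally show ?thesis by simp
  qed
  ultimately show ?thesis by blast
qed

text \<open>An extra node that absorbs the excess of every node along an extra arc makes all excesses zero, and
rounding the extra arcs rounds the excesses.\<close>

theorem flow_rounding:
  fixes en :: "'a \<Rightarrow> bool \<Rightarrow> 'n" and x :: "'a \<Rightarrow> real"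
  assumes fin: "finite A"
  obtains y :: "'a \<Rightarrow> int" where "\<And>a. a \<in> A \<Longrightarrow> \<bar>real_of_int (y a) - x a\<bar> < 1"
    and "\<And>p. \<bar>real_of_int (excess en A y p) - excess en A x p\<bar> < 1"
proof -
  define P where "P = (\<lambda>q. en (fst q) (snd q)) ` (A \<times> UNIV)"
  have finP: "finite P" unfolding P_def using fin by simp
  have P: "en a b \<in> P" if "a \<in> A" for a b using that unfolding P_def by force
  define A' where "A' = (Inl ` A \<union> Inr ` P :: ('a + 'n) set)"
  define en' where "en' q b = (case q of Inl a \<Rightarrow> Some (en a b) | Inr p \<Rightarrow> if b then None else Some p)"
    for q :: "'a + 'n" and b
  define x' where "x' q = (case q of Inl a \<Rightarrow> x a | Inr p \<Rightarrow> - excess en A x p)" for q :: "'a + 'n"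
  have finA': "finite A'" unfolding A'_def using fin finP by simp
  have split: "excess en' A' g q = (\<Sum>a\<in>A. (if en' (Inl a) False = q then g (Inl a) else 0)
        - (if en' (Inl a) True = q then g (Inl a) else 0))
      + (\<Sum>p\<in>P. (if en' (Inr p) False = q then g (Inr p) else 0) - (if en' (Inr p) True = q then g (Inr p) else 0))"
    for g :: "'a + 'n \<Rightarrow> 'r::ab_group_add" and q
    unfolding excess_def A'_def using fin finP
    by (subst sum.union_disjoint) (auto simp: sum.reindex)
  have at_Some: "excess en' A' g (Some p) = excess en A (\<lambda>a. g (Inl a)) p + (if p \<in> P then g (Inr p) else 0)"
    for g :: "'a + 'n \<Rightarrow> 'r::ab_group_add" and p
    unfolding split unfolding excess_def en'_def using finP by simp
  have outside: "excess en A g p = 0" if "p \<notin> P" for g :: "'a \<Rightarrow> 'r::ab_group_add" and p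
    unfolding excess_def using that P by (intro sum.neutral) auto
  have "excess en' A' x' q = 0" for q
  proof (cases q)
    case None
    have "excess en' A' x' None = (\<Sum>p\<in>P. excess en A x p)"
      unfolding split by (simp add: en'_def x'_def)
    also have "\<dots> = (\<Sum>a\<in>A. \<Sum>p\<in>P. (if en a False = p then x a else 0) - (if en a True = p then x a else 0))"
      unfolding excess_def by (rule sum.swap)
    also have "\<dots> = 0" using P finP by (intro sum.neutral) (auto simp: sum_subtractf)
    finally show ?thesis using None by simp
  next
    case (Some p)
    have "excess en A (\<lambda>a. x' (Inl a)) p = excess en A x p" by (simp add: x'_def)
    then show ?thesis unfolding Some at_Some using outside[of p x] by (simp add: x'_def)
  qed
  then obtain y :: "'a + 'n \<Rightarrow> int" where y: "\<And>a. a \<in> A' \<Longrightarrow> \<bar>real_of_int (y a) - x' a\<bar> < 1"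
    "\<And>p. excess en' A' y p = 0"
    using round_integral_excess[OF finA', of en' x'] by auto
  show thesis
  proof
    show "\<bar>real_of_int (y (Inl a)) - x a\<bar> < 1" if "a \<in> A" for a
      using y(1)[of "Inl a"] that unfolding A'_def x'_def by simp
    show "\<bar>real_of_int (excess en A (\<lambda>a. y (Inl a)) p) - excess en A x p\<bar> < 1" for p
    proof (cases "p \<in> P")
      case True
      then have "excess en A (\<lambda>a. y (Inl a)) p = - y (Inr p)" using y(2)[of "Some p"] unfolding at_Some by simp
      moreover have "\<bar>real_of_int (y (Inr p)) - x' (Inr p)\<bar> < 1" using y(1) True unfolding A'_def by simp
      ultimately show ?thesis unfolding x'_def by simp
    next
      case False
      then show ?thesis by (simp add: outside)
    qed
  qed
qed

section \<open>Balanced orientations and proportional edge sets\<close>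

definition enddeg :: "('e \<Rightarrow> bool \<Rightarrow> 'v) \<Rightarrow> bool \<Rightarrow> 'e set \<Rightarrow> 'v \<Rightarrow> int" where
  "enddeg en b F v = int (card {e \<in> F. en e b = v})"

lemma enddeg_eq_sum: "finite F \<Longrightarrow> enddeg en b F v = (\<Sum>e\<in>F. if en e b = v then 1 else 0)"
  unfolding enddeg_def by (simp add: sum.If_cases Int_def)

lemma enddeg_Diff:
  assumes "finite E" "F \<subseteq> E"
  shows "enddeg en b (E - F) v = enddeg en b E v - enddeg en b F v"
  using sum.subset_diff[OF assms(2,1), of "\<lambda>e. if en e b = v then 1 else 0 :: int"] assms
  by (simp add: enddeg_eq_sum finite_subset)

lemma deg_eq_enddeg: "finite F \<Longrightarrow> int (deg en F v) = enddeg en False F v + enddeg en True F v"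
  unfolding deg_eq_sum enddeg_eq_sum of_nat_sum sum.distrib[symmetric] by (intro sum.cong) auto

definition net :: "('e \<Rightarrow> bool \<Rightarrow> 'v) \<Rightarrow> 'e set \<Rightarrow> 'v \<Rightarrow> int" where
  "net en F v = enddeg en False F v - enddeg en True F v"

lemma net_eq_sum: "finite F \<Longrightarrow>
    net en F v = (\<Sum>e\<in>F. (if en e False = v then 1 else 0) - (if en e True = v then 1 else 0))"
  unfolding net_def enddeg_eq_sum by (simp add: sum_subtractf)

lemma net_Diff:
  assumes "finite E" "F \<subseteq> E"
  shows "net en (E - F) v = net en E v - net en F v"
  unfolding net_def enddeg_Diff[OF assms] by simp

lemma even_deg_iff_even_net:
  assumes "finite F"
  shows "even (deg en F v) \<longleftrightarrow> even (net en F v)"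
proof -
  have "even (int (deg en F v)) \<longleftrightarrow> even (net en F v)"
    unfolding deg_eq_enddeg[OF assms] net_def by simp
  then show ?thesis by simp
qed

lemma zero_one_of_near:
  assumes "\<bar>real_of_int y - c\<bar> < 1" "0 \<le> c" "c \<le> 1"
  shows "y = 0 \<or> y = 1"
proof -
  have "real_of_int y > -1" "real_of_int y < 2" using assms by linarith+
  then have "y > -1" "y < 2" by linarith+
  then show ?thesis by linarith
qed

text \<open>Starting from any orientation, round the flow that is \<open>1 / 2\<close> on every arc and reverse the arcs that
receive 1. Reversing half of every arc would balance the orientation exactly, and rounding changes
the excess by less than 1, hence the net degree by less than 2.\<close>

theorem balanced_orientation:
  fixes en :: "'e \<Rightarrow> bool \<Rightarrow> 'v"
  assumes fin: "finite E"
  obtains en' where "\<And>F v. F \<subseteq> E \<Longrightarrow> deg en' F v = deg en F v" "\<And>v. \<bar>net en' E v\<bar> \<le> 1"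
proof -
  obtain y where y: "\<And>a. a \<in> E \<Longrightarrow> \<bar>real_of_int (y a) - 1 / 2\<bar> < 1"
    "\<And>p. \<bar>real_of_int (excess en E y p) - excess en E (\<lambda>_. 1 / 2) p\<bar> < 1"
    using flow_rounding[OF fin, of "\<lambda>_. 1 / 2" en] by blast
  define en' where "en' e b = (if y e = 1 then en e (\<not> b) else en e b)" for e b
  show thesis
  proof
    show "deg en' F v = deg en F v" if "F \<subseteq> E" for F v
    proof -
      have "finite F" using that fin finite_subset by blast
      then show ?thesis unfolding deg_eq_sum[OF \<open>finite F\<close>] by (intro sum.cong) (auto simp: en'_def)
    qed
    show "\<bar>net en' E v\<bar> \<le> 1" for v
    proof -
      have "real_of_int (net en' E v) = (\<Sum>e\<in>E. 2 * ((if en e False = v then 1 / 2 else 0) - (if en e True = v then 1 / 2 else 0))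
         - 2 * ((if en e False = v then real_of_int (y e) else 0) - (if en e True = v then real_of_int (y e) else 0)))"
        unfolding net_eq_sum[OF fin] of_int_sum
        by (intro sum.cong refl) (use zero_one_of_near[OF y(1)] in \<open>force simp: en'_def\<close>)
      also have "\<dots> = 2 * excess en E (\<lambda>_. 1 / 2) v - 2 * real_of_int (excess en E y v)"
        unfolding excess_of_int[symmetric] unfolding excess_def by (simp only: sum_subtractf sum_distrib_left[symmetric])
      finally have "\<bar>real_of_int (net en' E v)\<bar> < 2" using y(2)[of v] by linarith
      then show ?thesis by linarith
    qed
  qed
qed

text \<open>Three quantities are controlled at a vertex: out-degree, in-degree and their difference. The bound on
the third does not follow from the other two, and it is the one that governs the parity of degrees.\<close>

definition proportional :: "('e \<Rightarrow> bool \<Rightarrow> 'v) \<Rightarrow> real \<Rightarrow> 'e set \<Rightarrow> 'e set \<Rightarrow> bool" where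
  "proportional en c E F \<longleftrightarrow> (\<forall>v. (\<forall>b. \<bar>real_of_int (enddeg en b F v) - c * real_of_int (enddeg en b E v)\<bar> < 1)
     \<and> \<bar>real_of_int (net en F v) - c * real_of_int (net en E v)\<bar> < 1)"

text \<open>Stretch every vertex to a path of three nodes, with the heads of arcs at the first and the tails at
the last, and round the flow that is \<open>c\<close> on every original arc. The arcs of the path carry the
scaled in-degree and out-degree, so that these are rounded as arc values; the net degree is the excess
of the middle node.\<close>

theorem proportional_subset_exists:
  fixes en :: "'e \<Rightarrow> bool \<Rightarrow> 'v"
  assumes fin: "finite E" and c: "0 \<le> c" "c \<le> 1"
  shows "\<exists>F\<subseteq>E. proportional en c E F"
proof -
  define P where "P = (\<lambda>q. en (fst q) (snd q)) ` (E \<times> UNIV)"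
  have finP: "finite P" unfolding P_def using fin by simp
  have P: "en e b \<in> P" if "e \<in> E" for e b using that unfolding P_def by force
  define A where "A = (Inl ` E \<union> Inr ` (P \<times> UNIV) :: ('e + 'v \<times> bool) set)"
  have finA: "finite A" unfolding A_def using fin finP by simp
  define en' :: "'e + 'v \<times> bool \<Rightarrow> bool \<Rightarrow> 'v \<times> nat" where
    "en' q b = (case q of Inl e \<Rightarrow> (en e b, if b then 0 else 2)
      | Inr (v, k) \<Rightarrow> (v, of_bool b + of_bool k))" for q b
  define x where "x q = (case q of Inl e \<Rightarrow> c | Inr (v, k) \<Rightarrow> c * real_of_int (enddeg en (\<not> k) E v))"
    for q :: "'e + 'v \<times> bool"
  have split: "excess en' A g q = (\<Sum>e\<in>E. (if en' (Inl e) False = q then g (Inl e) else 0)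
        - (if en' (Inl e) True = q then g (Inl e) else 0))
      + (\<Sum>v\<in>P. ((if en' (Inr (v, False)) False = q then g (Inr (v, False)) else 0)
          - (if en' (Inr (v, False)) True = q then g (Inr (v, False)) else 0))
        + ((if en' (Inr (v, True)) False = q then g (Inr (v, True)) else 0)
          - (if en' (Inr (v, True)) True = q then g (Inr (v, True)) else 0)))"
    for g :: "'e + 'v \<times> bool \<Rightarrow> 'r::ab_group_add" and q
  proof -
    have "excess en' A g q = (\<Sum>e\<in>E. (if en' (Inl e) False = q then g (Inl e) else 0)
        - (if en' (Inl e) True = q then g (Inl e) else 0))
      + (\<Sum>r\<in>P \<times> UNIV. (if en' (Inr (fst r, snd r)) False = q then g (Inr (fst r, snd r)) else 0)
          - (if en' (Inr (fst r, snd r)) True = q then g (Inr (fst r, snd r)) else 0))"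
      unfolding excess_def A_def using fin finP
      by (subst sum.union_disjoint) (auto simp: sum.reindex cong: if_cong)
    then show ?thesis
      using sum_over_ends[OF finP, of "\<lambda>v k. (if en' (Inr (v, k)) False = q then g (Inr (v, k)) else 0)
          - (if en' (Inr (v, k)) True = q then g (Inr (v, k)) else 0)"] by (simp only:)
  qed
  have at0: "excess en' A g (v, 0) = g (Inr (v, False)) - (\<Sum>e\<in>E. if en e True = v then g (Inl e) else 0)"
    and at1: "excess en' A g (v, 1) = g (Inr (v, True)) - g (Inr (v, False))"
    and at2: "excess en' A g (v, 2) = (\<Sum>e\<in>E. if en e False = v then g (Inl e) else 0) - g (Inr (v, True))"
    if "v \<in> P" for g :: "'e + 'v \<times> bool \<Rightarrow> 'r::ab_group_add" and v
    unfolding split using that finP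
    by (simp_all add: en'_def sum_negf sum_subtractf sum.distrib cong: if_cong)
  obtain y where y: "\<And>a. a \<in> A \<Longrightarrow> \<bar>real_of_int (y a) - x a\<bar> < 1"
    "\<And>p. \<bar>real_of_int (excess en' A y p) - excess en' A x p\<bar> < 1"
    using flow_rounding[OF finA, of x en'] by blast
  define F where "F = {e \<in> E. y (Inl e) = 1}"
  have FE: "F \<subseteq> E" unfolding F_def by blast
  have finF: "finite F" using FE fin finite_subset by blast
  have y01: "y (Inl e) = (if e \<in> F then 1 else 0)" if "e \<in> E" for e
    using zero_one_of_near[of "y (Inl e)" c] y(1)[of "Inl e"] that c unfolding A_def x_def F_def by auto
  have sum_y: "(\<Sum>e\<in>E. if en e b = v then y (Inl e) else 0) = enddeg en b F v" for b v
    unfolding enddeg_eq_sum[OF finF] using fin FE y01 by (intro sum.mono_neutral_cong_right) auto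
  have sum_x: "(\<Sum>e\<in>E. if en e b = v then x (Inl e) else 0) = c * real_of_int (enddeg en b E v)" for b v
    unfolding enddeg_eq_sum[OF fin] of_int_sum sum_distrib_left
    by (intro sum.cong) (auto simp: x_def)
  have "(\<forall>b. \<bar>real_of_int (enddeg en b F v) - c * real_of_int (enddeg en b E v)\<bar> < 1)
     \<and> \<bar>real_of_int (net en F v) - c * real_of_int (net en E v)\<bar> < 1" for v
  proof (cases "v \<in> P")
    case True
    have "excess en' A x (v, 0) = 0" "excess en' A x (v, 2) = 0"
      unfolding at0[OF True] at2[OF True] sum_x by (simp_all add: x_def)
    then have "excess en' A y (v, 0) = 0" "excess en' A y (v, 2) = 0"
      using y(2)[of "(v, 0)"] y(2)[of "(v, 2)"] by simp_all
    then have pass: "y (Inr (v, False)) = enddeg en True F v" "y (Inr (v, True)) = enddeg en False F v"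
      unfolding at0[OF True] at2[OF True] sum_y by simp_all
    have "\<bar>real_of_int (enddeg en b F v) - c * real_of_int (enddeg en b E v)\<bar> < 1" for b
      using y(1)[of "Inr (v, \<not> b)"] True pass unfolding A_def x_def by (cases b) auto
    moreover have "excess en' A x (v, 1) = c * real_of_int (net en E v)"
      unfolding at1[OF True] net_def by (simp add: x_def right_diff_distrib)
    moreover have "excess en' A y (v, 1) = net en F v"
      unfolding at1[OF True] pass net_def by simp
    ultimately show ?thesis using y(2)[of "(v, 1)"] by simp
  next
    case False
    then have "enddeg en b E v = 0" "enddeg en b F v = 0" for b
      using P FE unfolding enddeg_def by (auto simp: card_eq_0_iff)
    then show ?thesis by (simp add: net_def)
  qed
  then show ?thesis using FE unfolding proportional_def by blast
qed

text \<open>Successive roundings with equal shares do not accumulate errors. If \<open>m \<le> \<theta> \<le> m + 1\<close>, then a rounding of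
\<open>p \<theta>\<close> lies between \<open>p m\<close> and \<open>p (m + 1)\<close>, so its \<open>p\<close>-th part again lies between \<open>m\<close> and \<open>m + 1\<close>, and if
\<open>\<theta> = m\<close> nothing is lost at all. This is where the equality of all weights but one enters.\<close>

lemma rounding_trans:
  fixes a b :: int and p :: nat
  assumes p: "p > 0" and a: "\<bar>real_of_int a - real p * \<theta>\<bar> < 1"
    and b: "\<bar>real_of_int b - 1 / real p * real_of_int a\<bar> < 1"
  shows "\<bar>real_of_int b - \<theta>\<bar> < 1"
proof -
  define m where "m = \<lfloor>\<theta>\<rfloor>"
  have m: "real_of_int m \<le> \<theta>" "\<theta> < real_of_int m + 1" unfolding m_def by linarith+
  have "real p * real_of_int m \<le> real p * \<theta>" using m(1) by (intro mult_left_mono) auto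
  then have "real_of_int (int p * m - 1) < real_of_int a" using a by simp
  then have lo: "int p * m \<le> a" unfolding of_int_less_iff by simp
  have pos: "real p > 0" using p by simp
  show ?thesis
  proof (cases "\<theta> = real_of_int m")
    case True
    then have "real_of_int a < real_of_int (int p * m + 1)" using a by simp
    then have "a = int p * m" using lo unfolding of_int_less_iff by simp
    then have "1 / real p * real_of_int a = real_of_int m" using pos by simp
    then show ?thesis using b True by simp
  next
    case False
    then have strict: "real_of_int m < \<theta>" using m by simp
    have "real p * \<theta> < real p * (real_of_int m + 1)" using m(2) pos by simp
    then have "real_of_int a < real_of_int (int p * (m + 1) + 1)" using a by simp
    then have hi: "a \<le> int p * (m + 1)" unfolding of_int_less_iff by simp
    have "real p * real_of_int m \<le> real_of_int a" "real_of_int a \<le> real p * (real_of_int m + 1)"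
      using of_int_le_iff[of "int p * m" a, where ?'a = real] of_int_le_iff[of a "int p * (m + 1)", where ?'a = real] lo hi
      by simp_all
    then have "real_of_int m \<le> 1 / real p * real_of_int a" "1 / real p * real_of_int a \<le> real_of_int m + 1"
      using pos by (simp_all add: field_simps)
    then have "real_of_int (m - 1) < real_of_int b" "real_of_int b < real_of_int (m + 2)" using b by simp_all
    then have "m \<le> b" "b \<le> m + 1" unfolding of_int_less_iff by simp_all
    then have "real_of_int m \<le> real_of_int b" "real_of_int b \<le> real_of_int m + 1" by linarith+
    then show ?thesis using strict m(2) by linarith
  qed
qed

lemma proportional_trans:
  assumes "p > 0" "proportional en (real p * c) E R" "proportional en (1 / real p) R F"
  shows "proportional en c E F"
proof -
  have *: "\<bar>real_of_int l - c * real_of_int k\<bar> < 1"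
    if "\<bar>real_of_int a - real p * c * real_of_int k\<bar> < 1"
      "\<bar>real_of_int l - 1 / real p * real_of_int a\<bar> < 1" for k a l
    using rounding_trans[OF assms(1), of a "c * real_of_int k" l] that by (simp add: mult.assoc)
  show ?thesis using assms(2,3) * unfolding proportional_def by meson
qed

lemma proportional_Diff:
  assumes "finite E" "F \<subseteq> E" "proportional en c E F"
  shows "proportional en (1 - c) E (E - F)"
proof -
  have *: "\<bar>(m - f) - (1 - c) * m\<bar> < 1" if "\<bar>f - c * m\<bar> < 1" for f m :: real
  proof -
    have "(m - f) - (1 - c) * m = - (f - c * m)" by (simp add: algebra_simps)
    then show ?thesis using that by (metis abs_minus_cancel)
  qed
  show ?thesis using assms(3) unfolding proportional_def
    by (simp add: enddeg_Diff[OF assms(1,2)] net_Diff[OF assms(1,2)] *)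
qed

theorem equal_parts:
  assumes "finite R" "n > 0"
  shows "\<exists>P :: nat \<Rightarrow> 'e set. disjoint_family_on P {..<n} \<and> (\<Union>i<n. P i) = R \<and>
    (\<forall>i<n. proportional en (1 / real n) R (P i))"
  using assms
proof (induction n arbitrary: R)
  case (Suc n)
  show ?case
  proof (cases "n = 0")
    case True
    have "proportional en 1 R R" unfolding proportional_def by simp
    then show ?thesis using True by (intro exI[of _ "\<lambda>_. R"]) (simp add: disjoint_family_on_def lessThan_Suc)
  next
    case False
    define c where "c = 1 / real (Suc n)"
    have c: "0 \<le> c" "c \<le> 1" "1 - c = real n * c" unfolding c_def by (auto simp: field_simps)
    obtain F where F: "F \<subseteq> R" "proportional en c R F"
      using proportional_subset_exists[OF Suc.prems(1) c(1,2)] by blast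
    have rest: "proportional en (real n * c) R (R - F)"
      using proportional_Diff[OF Suc.prems(1) F] c(3) by simp
    obtain P where P: "disjoint_family_on P {..<n}" "(\<Union>i<n. P i) = R - F"
      "\<And>i. i < n \<Longrightarrow> proportional en (1 / real n) (R - F) (P i)"
      using Suc.IH[of "R - F"] Suc.prems(1) False by auto
    define Q where "Q = P(n := F)"
    have PF: "P i \<inter> F = {}" "F \<inter> P i = {}" if "i < n" for i using P(2) that by blast+
    have "disjoint_family_on Q {..<Suc n}"
    proof (unfold disjoint_family_on_def, intro ballI impI)
      fix i j assume "i \<in> {..<Suc n}" "j \<in> {..<Suc n}" "i \<noteq> j"
      then show "Q i \<inter> Q j = {}"
        using PF disjoint_family_onD[OF P(1), of i j] by (cases "i = n"; cases "j = n") (auto simp: Q_def)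
    qed
    moreover have "(\<Union>i<Suc n. Q i) = R"
    proof -
      have "(\<Union>i<Suc n. Q i) = Q n \<union> (\<Union>i<n. Q i)" by (simp add: lessThan_Suc)
      also have "\<dots> = F \<union> (\<Union>i<n. P i)" unfolding Q_def by simp
      finally show ?thesis unfolding P(2) using F(1) by (simp add: Un_absorb1)
    qed
    moreover have "proportional en c R (Q i)" if "i < Suc n" for i
      using that F(2) proportional_trans[OF _ rest P(3)[of i]] False
      by (cases "i = n") (auto simp: Q_def)
    ultimately show ?thesis unfolding c_def by blast
  qed
qed simp

section \<open>Subgraphs of prescribed parity\<close>

text \<open>The degree in \<open>F\<close> should be \<open>f v\<close>, the least number of the right parity not below \<open>\<epsilon> d v\<close>, or \<open>f v - 2\<close>. A
loop at \<open>v\<close> expresses this choice: a factor of the enlarged graph with degrees \<open>f\<close> uses it or not. Weight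
\<open>\<epsilon>\<close> on the edges, and half of what is missing to \<open>f v\<close> on the loop, form a fractional factor. Loops lie in no cut, so the
cut inequality compares \<open>\<epsilon> |cut - D| + (1 - \<epsilon>) |D|\<close> with 1, where the size of the cut and \<open>|D|\<close> have
different parities. For empty \<open>D\<close> this is the hypothesis on odd cuts, and otherwise the cut has an
edge outside \<open>D\<close>, which contributes at least \<open>\<epsilon> + (1 - \<epsilon>)\<close>.\<close>

lemma parity_factor:
  fixes en :: "'e \<Rightarrow> bool \<Rightarrow> 'v" and \<epsilon> :: real
  assumes finV: "finite V" and finE: "finite E" and en_in: "\<And>e b. e \<in> E \<Longrightarrow> en e b \<in> V"
    and \<epsilon>: "0 \<le> \<epsilon>" "\<epsilon> \<le> 1"
    and conn: "\<And>C. C \<subseteq> V \<Longrightarrow> odd (card (edge_cut en E C)) \<Longrightarrow> 1 \<le> \<epsilon> * real (card (edge_cut en E C))"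
  shows "\<exists>F\<subseteq>E. \<forall>v\<in>V. (even (deg en F v) \<longleftrightarrow> even (deg en E v)) \<and>
    \<bar>real (deg en F v) - \<epsilon> * real (deg en E v)\<bar> < 2"
proof -
  define d where "d v = deg en E v" for v
  define m where "m v = nat \<lceil>\<epsilon> * real (d v)\<rceil>" for v
  define f where "f v = (if even (m v) \<longleftrightarrow> even (d v) then m v else m v + 1)" for v
  have f_parity: "even (f v) \<longleftrightarrow> even (d v)" for v unfolding f_def by auto
  have m: "\<epsilon> * real (d v) \<le> real (m v)" "real (m v) < \<epsilon> * real (d v) + 1" for v
    using \<epsilon> unfolding m_def by (simp_all add: of_nat_nat, linarith+)
  have f_bounds: "\<epsilon> * real (d v) \<le> real (f v)" "real (f v) < \<epsilon> * real (d v) + 2" for v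
    using m[of v] unfolding f_def by auto
  define \<theta> where "\<theta> v = (real (f v) - \<epsilon> * real (d v)) / 2" for v
  have \<theta>: "0 \<le> \<theta> v" "\<theta> v \<le> 1" for v using f_bounds[of v] unfolding \<theta>_def by auto
  \<comment> \<open>No loop where \<open>f v\<close> is exact, since \<open>f v - 2\<close> would then be too far from \<open>\<epsilon> d v\<close>.\<close>
  define L where "L = {v \<in> V. \<theta> v \<noteq> 0}"
  define E' where "E' = (Inl ` E \<union> Inr ` L :: ('e + 'v) set)"
  define en' where "en' q b = (case q of Inl e \<Rightarrow> en e b | Inr v \<Rightarrow> v)" for q b
  define x where "x q = (case q of Inl e \<Rightarrow> \<epsilon> | Inr v \<Rightarrow> \<theta> v)" for q :: "'e + 'v"
  have finL: "finite L" and finE': "finite E'" unfolding L_def E'_def using finV finE by auto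
  have cut_eq: "edge_cut en' E' C = Inl ` edge_cut en E C" for C
    unfolding edge_cut_def E'_def en'_def by auto
  have "fractional_factor V E' en' x f"
  proof
    show "finite V" "finite E'" by fact+
    show "en' e b \<in> V" if "e \<in> E'" for e b
      using that en_in unfolding E'_def en'_def L_def by auto
    show "0 \<le> x e" "x e \<le> 1" for e using \<epsilon> \<theta> unfolding x_def by (auto split: sum.splits)
    show "(\<Sum>p\<in>half_edges en' E' v. x (fst p)) = real (f v)" if v: "v \<in> V" for v
    proof -
      have "(\<Sum>p\<in>half_edges en' E' v. x (fst p)) =
          (\<Sum>e\<in>E. (if en e False = v then \<epsilon> else 0) + (if en e True = v then \<epsilon> else 0))
          + (\<Sum>w\<in>L. (if w = v then \<theta> w else 0) + (if w = v then \<theta> w else 0))"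
        unfolding sum_half_edges[OF finE', of "\<lambda>e _. x e" en' v] unfolding E'_def using finE finL
        by (subst sum.union_disjoint) (auto simp: sum.reindex en'_def x_def cong: if_cong)
      also have "(\<Sum>e\<in>E. (if en e False = v then \<epsilon> else 0) + (if en e True = v then \<epsilon> else 0))
          = \<epsilon> * real (d v)"
        unfolding d_def deg_eq_sum[OF finE] of_nat_sum sum_distrib_left by (intro sum.cong) auto
      also have "(\<Sum>w\<in>L. (if w = v then \<theta> w else 0) + (if w = v then \<theta> w else 0)) = 2 * \<theta> v"
      proof -
        have "(\<Sum>w\<in>L. (if w = v then \<theta> w else 0) + (if w = v then \<theta> w else 0)) = (if v \<in> L then 2 * \<theta> v else 0)"
          unfolding sum.distrib sum.delta[OF finL] by simp
        then show ?thesis using v by (auto simp: L_def)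
      qed
      finally show ?thesis unfolding \<theta>_def by (simp add: field_simps)
    qed
    show "1 \<le> (\<Sum>e\<in>edge_cut en' E' C - D. x e) + (\<Sum>e\<in>D. 1 - x e)"
      if C: "C \<subseteq> V" and D: "D \<subseteq> edge_cut en' E' C" and odd: "odd ((\<Sum>v\<in>C. f v) + card D)" for C D
    proof -
      have finC: "finite C" using C finV finite_subset by blast
      have fincut: "finite (edge_cut en' E' C)" using finE' by simp
      have finD: "finite D" using D fincut finite_subset by blast
      have x_cut: "x e = \<epsilon>" if "e \<in> edge_cut en' E' C" for e using that unfolding cut_eq x_def by auto
      have "(\<Sum>e\<in>edge_cut en' E' C - D. x e) = (\<Sum>e\<in>edge_cut en' E' C - D. \<epsilon>)"
        by (rule sum.cong) (use x_cut in auto)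
      moreover have "(\<Sum>e\<in>D. 1 - x e) = (\<Sum>e\<in>D. 1 - \<epsilon>)" by (rule sum.cong) (use x_cut D in auto)
      ultimately have cut_value: "(\<Sum>e\<in>edge_cut en' E' C - D. x e) + (\<Sum>e\<in>D. 1 - x e)
          = \<epsilon> * real (card (edge_cut en' E' C - D)) + (1 - \<epsilon>) * real (card D)" by simp
      have card_cut: "card (edge_cut en' E' C) = card (edge_cut en E C)"
        unfolding cut_eq by (rule card_image) (auto simp: inj_on_def)
      have split: "card (edge_cut en' E' C) = card (edge_cut en' E' C - D) + card D"
        using D fincut finD by (metis card_Diff_subset card_mono le_add_diff_inverse2)
      have "even ((\<Sum>v\<in>C. deg en E v) + card (edge_cut en E C))" by (rule handshake_parity[OF finE finC])
      moreover have "even ((\<Sum>v\<in>C. f v) + (\<Sum>v\<in>C. deg en E v))"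
        unfolding sum.distrib[symmetric] using f_parity unfolding d_def by (intro dvd_sum) simp
      ultimately have parity: "odd (card (edge_cut en' E' C) + card D)"
        using odd unfolding card_cut by (simp only: even_add) blast
      show ?thesis
      proof (cases "card D = 0")
        case True
        then have "odd (card (edge_cut en E C))" using parity unfolding card_cut by simp
        from conn[OF C this] show ?thesis unfolding cut_value using True split card_cut by simp
      next
        case False
        have "odd (card (edge_cut en' E' C - D))" using parity unfolding split by (simp only: even_add) blast
        then have "1 \<le> card (edge_cut en' E' C - D)" by (cases "card (edge_cut en' E' C - D)") auto
        then have "\<epsilon> * 1 \<le> \<epsilon> * real (card (edge_cut en' E' C - D))" using \<epsilon> by (intro mult_left_mono) auto
        moreover have "(1 - \<epsilon>) * 1 \<le> (1 - \<epsilon>) * real (card D)" using \<epsilon> False by (intro mult_left_mono) auto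
        ultimately show ?thesis unfolding cut_value by simp
      qed
    qed
  qed
  then have "\<exists>F\<subseteq>E'. \<forall>v\<in>V. deg en' F v = f v" by (rule fractional_factor.factor_exists)
  then obtain F' where F': "F' \<subseteq> E'" "\<And>v. v \<in> V \<Longrightarrow> deg en' F' v = f v" by blast
  define F where "F = {e \<in> E. Inl e \<in> F'}"
  have FE: "F \<subseteq> E" unfolding F_def by blast
  have finF: "finite F" using FE finE finite_subset by blast
  have f_eq: "f v = deg en F v + (if Inr v \<in> F' then 2 else 0)" if v: "v \<in> V" for v
  proof -
    have F'_eq: "F' = Inl ` F \<union> Inr ` {w \<in> L. Inr w \<in> F'}" using F'(1) unfolding F_def E'_def by auto
    have "f v = deg en' F' v" using F'(2)[OF v] by simp
    also have "\<dots> = deg en' (Inl ` F \<union> Inr ` {w \<in> L. Inr w \<in> F'}) v" using F'_eq by simp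
    also have "\<dots> = (\<Sum>e\<in>F. (if en e False = v then 1 else 0) + (if en e True = v then 1 else 0))
        + (\<Sum>w\<in>{w \<in> L. Inr w \<in> F'}. (if w = v then 1 else 0) + (if w = v then 1 else 0))"
      using finF finL
      by (subst deg_eq_sum, simp, subst sum.union_disjoint) (auto simp: sum.reindex en'_def cong: if_cong)
    also have "\<dots> = deg en F v + (if Inr v \<in> F' then 2 else 0)"
      using F'(1) finL unfolding deg_eq_sum[OF finF] E'_def by (auto simp: sum.distrib)
    finally show ?thesis .
  qed
  have "(even (deg en F v) \<longleftrightarrow> even (deg en E v)) \<and> \<bar>real (deg en F v) - \<epsilon> * real (deg en E v)\<bar> < 2"
    if v: "v \<in> V" for v
  proof
    show "even (deg en F v) \<longleftrightarrow> even (deg en E v)" using f_parity[of v] f_eq[OF v] unfolding d_def by (auto split: if_splits)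
    show "\<bar>real (deg en F v) - \<epsilon> * real (deg en E v)\<bar> < 2"
    proof (cases "Inr v \<in> F'")
      case True
      then have "v \<in> L" using F'(1) unfolding E'_def by auto
      then have "\<epsilon> * real (d v) \<noteq> real (f v)" unfolding L_def \<theta>_def by auto
      then show ?thesis using f_bounds[of v] f_eq[OF v] True unfolding d_def by auto
    next
      case False
      then show ?thesis using f_bounds[of v] f_eq[OF v] unfolding d_def by auto
    qed
  qed
  then show ?thesis using FE by blast
qed

section \<open>Decompositions indexed by edge sets\<close>

lemma first_part_and_equal_rest:
  fixes E :: "'e set" and k :: nat
  assumes fin: "finite E" and F: "F \<subseteq> E" and k: "1 \<le> k" "k = 1 \<longrightarrow> F = E"
  obtains Q :: "nat \<Rightarrow> 'e set" where "disjoint_family_on Q {1..k}" "(\<Union>i\<in>{1..k}. Q i) = E" "Q 1 = F"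
    "\<And>i. i \<in> {2..k} \<Longrightarrow> Q i \<subseteq> E - F \<and> proportional en (1 / real (k - 1)) (E - F) (Q i)"
proof (cases "k = 1")
  case True
  show thesis by (rule that[of "\<lambda>_. E"]) (use True k in \<open>auto simp: disjoint_family_on_def\<close>)
next
  case False
  have "\<exists>P :: nat \<Rightarrow> 'e set. disjoint_family_on P {..<k - 1} \<and> (\<Union>i<k - 1. P i) = E - F \<and>
      (\<forall>i<k - 1. proportional en (1 / real (k - 1)) (E - F) (P i))"
    by (rule equal_parts) (use fin k False in auto)
  then obtain P where P: "disjoint_family_on P {..<k - 1}" "(\<Union>i<k - 1. P i) = E - F"
    "\<And>i. i < k - 1 \<Longrightarrow> proportional en (1 / real (k - 1)) (E - F) (P i)" by blast
  define Q where "Q i = (if i = 1 then F else P (i - 2))" for i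
  have sub: "Q i \<subseteq> E - F" if "i \<in> {2..k}" for i
    using that P(2) unfolding Q_def by (auto simp: set_eq_iff)
  show thesis
  proof (rule that[of Q])
    show "Q 1 = F" unfolding Q_def by simp
    show "Q i \<subseteq> E - F \<and> proportional en (1 / real (k - 1)) (E - F) (Q i)" if i: "i \<in> {2..k}" for i
      using sub[OF i] P(3)[of "i - 2"] i unfolding Q_def by auto
    show "disjoint_family_on Q {1..k}"
      unfolding disjoint_family_on_def
    proof (intro ballI impI)
      fix i j assume ij: "i \<in> {1..k}" "j \<in> {1..k}" "i \<noteq> j"
      consider "i = 1" "j \<in> {2..k}" | "j = 1" "i \<in> {2..k}" | "i \<in> {2..k}" "j \<in> {2..k}"
        using ij by fastforce
      then show "Q i \<inter> Q j = {}"
      proof cases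
        case 1
        then show ?thesis using sub[of j] unfolding Q_def by auto
      next
        case 2
        then show ?thesis using sub[of i] unfolding Q_def by auto
      next
        case 3
        then have "P (i - 2) \<inter> P (j - 2) = {}"
          using ij by (intro disjoint_family_onD[OF P(1)]) auto
        then show ?thesis using 3 unfolding Q_def by auto
      qed
    qed
    show "(\<Union>i\<in>{1..k}. Q i) = E"
    proof -
      have "{1..k} = insert 1 ((\<lambda>i. i + 2) ` {..<k - 1})"
      proof (intro set_eqI iffI)
        fix i assume "i \<in> {1..k}"
        then have "i = 1 \<or> i = (i - 2) + 2 \<and> i - 2 < k - 1" using False by auto
        then show "i \<in> insert 1 ((\<lambda>i. i + 2) ` {..<k - 1})" by blast
      qed (use k in auto)
      moreover have "Q 1 = F" "\<And>i. Q (i + 2) = P i" unfolding Q_def by simp_all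
      ultimately have "(\<Union>i\<in>{1..k}. Q i) = F \<union> (\<Union>i<k - 1. P i)"
        by (simp only: UN_insert image_image)
      then show ?thesis using P(2) F by auto
    qed
  qed
qed

lemma net_Union:
  assumes "finite I" "disjoint_family_on Q I" "finite (\<Union>i\<in>I. Q i)"
  shows "net en (\<Union>i\<in>I. Q i) v = (\<Sum>i\<in>I. net en (Q i) v)"
proof -
  have fin: "finite (Q i)" if "i \<in> I" for i using assms(3) that by (meson UN_upper finite_subset)
  have "net en (\<Union>i\<in>I. Q i) v =
      (\<Sum>i\<in>I. \<Sum>e\<in>Q i. (if en e False = v then 1 else 0) - (if en e True = v then 1 else 0))"
    unfolding net_eq_sum[OF assms(3)]
    by (rule sum.UNION_disjoint) (use assms fin in \<open>auto simp: disjoint_family_on_def\<close>)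
  also have "\<dots> = (\<Sum>i\<in>I. net en (Q i) v)" by (intro sum.cong refl) (simp add: net_eq_sum fin)
  finally show ?thesis .
qed

lemma deg_near_of_proportional:
  assumes "finite F" "finite E" "proportional en c E F"
  shows "\<bar>real (deg en F v) - c * real (deg en E v)\<bar> < 2"
proof -
  have "real (deg en F v) = real_of_int (enddeg en False F v) + real_of_int (enddeg en True F v)"
    "real (deg en E v) = real_of_int (enddeg en False E v) + real_of_int (enddeg en True E v)"
    using deg_eq_enddeg[OF assms(1), of en v] deg_eq_enddeg[OF assms(2), of en v] by linarith+
  moreover have "\<bar>real_of_int (enddeg en False F v) - c * real_of_int (enddeg en False E v)\<bar> < 1"
    "\<bar>real_of_int (enddeg en True F v) - c * real_of_int (enddeg en True E v)\<bar> < 1"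
    using assms(3) unfolding proportional_def by blast+
  ultimately show ?thesis by (simp add: distrib_left)
qed

text \<open>Errors below 1 in the in-degree and the out-degree add up to less than 2. For the parity, let \<open>s\<close> be the
net degree of the whole orientation, so that \<open>s\<close> is 0, 1 or -1. The net degree of each part differs by
less than 1 from \<open>\<epsilon> i s\<close>, so it never has the sign opposite to \<open>s\<close>; as the net degrees add up to \<open>s\<close>,
at most one of them is nonzero.\<close>

theorem balanced_decomposition:
  fixes en :: "'e \<Rightarrow> bool \<Rightarrow> 'v" and \<epsilon> :: "nat \<Rightarrow> real"
  assumes fin: "finite E" and k: "1 \<le> k" "k = 1 \<longrightarrow> \<epsilon> 1 = 1"
    and \<epsilon>1: "0 \<le> \<epsilon> 1" "\<epsilon> 1 \<le> 1" and rest: "\<And>i. i \<in> {2..k} \<Longrightarrow> real (k - 1) * \<epsilon> i = 1 - \<epsilon> 1"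
    and \<epsilon>: "\<And>i. i \<in> {1..k} \<Longrightarrow> 0 \<le> \<epsilon> i"
  shows "\<exists>Q :: nat \<Rightarrow> 'e set. disjoint_family_on Q {1..k} \<and> (\<Union>i\<in>{1..k}. Q i) = E \<and>
    (\<forall>v. \<forall>i\<in>{1..k}. \<bar>real (deg en (Q i) v) - \<epsilon> i * real (deg en E v)\<bar> < 2) \<and>
    (\<forall>v. \<exists>\<^sub>\<le>\<^sub>1 j. j \<in> {1..k} \<and> odd (deg en (Q j) v))"
proof -
  obtain en' where en': "\<And>F v. F \<subseteq> E \<Longrightarrow> deg en' F v = deg en F v" "\<And>v. \<bar>net en' E v\<bar> \<le> 1"
    using balanced_orientation[OF fin, of en] by blast
  have "\<exists>F\<subseteq>E. proportional en' (\<epsilon> 1) E F \<and> (k = 1 \<longrightarrow> F = E)"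
  proof (cases "k = 1")
    case True
    then show ?thesis using k by (intro exI[of _ E]) (simp add: proportional_def)
  next
    case False
    then show ?thesis using proportional_subset_exists[OF fin \<epsilon>1] by blast
  qed
  then obtain F where F: "F \<subseteq> E" "proportional en' (\<epsilon> 1) E F" "k = 1 \<longrightarrow> F = E" by blast
  obtain Q :: "nat \<Rightarrow> 'e set" where Q: "disjoint_family_on Q {1..k}" "(\<Union>i\<in>{1..k}. Q i) = E" "Q 1 = F"
    "\<And>i. i \<in> {2..k} \<Longrightarrow> Q i \<subseteq> E - F \<and> proportional en' (1 / real (k - 1)) (E - F) (Q i)"
    using first_part_and_equal_rest[OF fin F(1) k(1) F(3), of en'] by blast
  have QE: "Q i \<subseteq> E" if "i \<in> {1..k}" for i using Q(2) that by blast
  have finQ: "finite (Q i)" if "i \<in> {1..k}" for i using QE[OF that] fin finite_subset by blast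
  have proportion: "proportional en' (\<epsilon> i) E (Q i)" if i: "i \<in> {1..k}" for i
  proof (cases "i = 1")
    case True
    then show ?thesis using F(2) Q(3) by simp
  next
    case False
    then have i2: "i \<in> {2..k}" using i by auto
    have "proportional en' (real (k - 1) * \<epsilon> i) E (E - F)"
      using proportional_Diff[OF fin F(1,2)] rest[OF i2] by simp
    then show ?thesis using proportional_trans[of "k - 1" en' "\<epsilon> i" E "E - F" "Q i"] Q(4)[OF i2] i2 by auto
  qed
  have "\<bar>real (deg en (Q i) v) - \<epsilon> i * real (deg en E v)\<bar> < 2" if i: "i \<in> {1..k}" for i v
    using deg_near_of_proportional[OF finQ[OF i] fin proportion[OF i], of v] en'(1)[OF QE[OF i]] en'(1)[OF order_refl]
    by simp
  moreover have "\<exists>\<^sub>\<le>\<^sub>1 j. j \<in> {1..k} \<and> odd (deg en (Q j) v)" for v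
  proof (rule Uniq_I, rule ccontr)
    fix i j assume i: "i \<in> {1..k} \<and> odd (deg en (Q i) v)" and j: "j \<in> {1..k} \<and> odd (deg en (Q j) v)"
      and ne: "i \<noteq> j"
    define s where "s = net en' E v"
    define t where "t l = s * net en' (Q l) v" for l
    have s: "s = -1 \<or> s = 0 \<or> s = 1" using en'(2)[of v] unfolding s_def by linarith
    have near: "\<bar>real_of_int (net en' (Q l) v) - \<epsilon> l * real_of_int s\<bar> < 1" if "l \<in> {1..k}" for l
      using proportion[OF that] unfolding proportional_def s_def by blast
    have nonneg: "0 \<le> t l" if l: "l \<in> {1..k}" for l
    proof -
      have "real_of_int (t l) > -1" using s near[OF l] \<epsilon>[OF l] unfolding t_def by auto
      then show ?thesis by linarith
    qed
    have pos: "1 \<le> t l" if l: "l \<in> {1..k} \<and> odd (deg en (Q l) v)" for l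
    proof -
      have "odd (net en' (Q l) v)"
        using l en'(1)[OF QE, of l v] even_deg_iff_even_net[OF finQ, of l en' v] by auto
      then have nz: "net en' (Q l) v \<noteq> 0" by (metis even_zero)
      moreover have "s \<noteq> 0" using nz near[of l] l by auto
      ultimately have "t l \<noteq> 0" unfolding t_def by simp
      then show ?thesis using nonneg[of l] l by simp
    qed
    have "(\<Sum>l\<in>{1..k}. t l) = s * s"
      unfolding t_def sum_distrib_left[symmetric] s_def
      using net_Union[OF finite_atLeastAtMost Q(1), unfolded Q(2), OF fin, of en' v] by simp
    then have "(\<Sum>l\<in>{1..k}. t l) \<le> 1" using s by auto
    moreover have "(\<Sum>l\<in>{i, j}. t l) \<le> (\<Sum>l\<in>{1..k}. t l)"
      using i j nonneg by (intro sum_mono2) auto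
    ultimately show False using ne pos[OF i] pos[OF j] by simp
  qed
  ultimately show ?thesis using Q(1,2) by blast
qed

text \<open>The first part is a parity factor, which leaves all degrees even. The rest has an orientation with
equal in- and out-degrees; in a proportional part the net degree is an integer of absolute value
less than 1, so the in-degree is half the degree and rounding in-degrees rounds half-degrees.\<close>

theorem parity_decomposition:
  fixes en :: "'e \<Rightarrow> bool \<Rightarrow> 'v" and \<epsilon> :: "nat \<Rightarrow> real"
  assumes finV: "finite V" and fin: "finite E" and en_in: "\<And>e b. e \<in> E \<Longrightarrow> en e b \<in> V"
    and k: "1 \<le> k" "k = 1 \<longrightarrow> \<epsilon> 1 = 1"
    and \<epsilon>1: "0 \<le> \<epsilon> 1" "\<epsilon> 1 \<le> 1" and rest: "\<And>i. i \<in> {2..k} \<Longrightarrow> real (k - 1) * \<epsilon> i = 1 - \<epsilon> 1"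
    and conn: "\<And>C. C \<subseteq> V \<Longrightarrow> odd (card (edge_cut en E C)) \<Longrightarrow> 1 \<le> \<epsilon> 1 * real (card (edge_cut en E C))"
  shows "\<exists>Q :: nat \<Rightarrow> 'e set. disjoint_family_on Q {1..k} \<and> (\<Union>i\<in>{1..k}. Q i) = E \<and>
    (\<forall>v\<in>V. \<forall>i\<in>{1..k}. \<bar>real (deg en (Q i) v) - \<epsilon> i * real (deg en E v)\<bar> < 2) \<and>
    (\<forall>v\<in>V. \<forall>i\<in>{2..k}. even (deg en (Q i) v)) \<and>
    (\<forall>v\<in>V. even (deg en (Q 1) v) \<longleftrightarrow> even (deg en E v))"
proof -
  have "\<exists>F\<subseteq>E. (\<forall>v\<in>V. (even (deg en F v) \<longleftrightarrow> even (deg en E v)) \<and>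
      \<bar>real (deg en F v) - \<epsilon> 1 * real (deg en E v)\<bar> < 2) \<and> (k = 1 \<longrightarrow> F = E)"
  proof (cases "k = 1")
    case True
    then show ?thesis using k by (intro exI[of _ E]) simp
  next
    case False
    then show ?thesis using parity_factor[OF finV fin en_in \<epsilon>1 conn] by blast
  qed
  then obtain F where F: "F \<subseteq> E" "k = 1 \<longrightarrow> F = E"
    "\<And>v. v \<in> V \<Longrightarrow> even (deg en F v) \<longleftrightarrow> even (deg en E v)"
    "\<And>v. v \<in> V \<Longrightarrow> \<bar>real (deg en F v) - \<epsilon> 1 * real (deg en E v)\<bar> < 2" by blast
  have finF: "finite F" using F(1) fin finite_subset by blast
  define R where "R = E - F"
  have finR: "finite R" unfolding R_def using fin by simp
  have deg_R: "deg en E v = deg en F v + deg en R v" for v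
    using sum.subset_diff[OF F(1) fin, of "\<lambda>e. (if en e False = v then 1 else 0) + (if en e True = v then 1 else 0 :: nat)"]
    unfolding deg_eq_sum[OF fin] deg_eq_sum[OF finF] deg_eq_sum[OF finR] by (simp add: R_def)
  obtain en' where en': "\<And>S v. S \<subseteq> R \<Longrightarrow> deg en' S v = deg en S v" "\<And>v. \<bar>net en' R v\<bar> \<le> 1"
    using balanced_orientation[OF finR, of en] by blast
  obtain Q :: "nat \<Rightarrow> 'e set" where Q: "disjoint_family_on Q {1..k}" "(\<Union>i\<in>{1..k}. Q i) = E" "Q 1 = F"
    "\<And>i. i \<in> {2..k} \<Longrightarrow> Q i \<subseteq> R \<and> proportional en' (1 / real (k - 1)) R (Q i)"
    using first_part_and_equal_rest[OF fin F(1) k(1) F(2), of en'] unfolding R_def by blast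
  have net_R: "net en' R v = 0" if v: "v \<in> V" for v
  proof -
    have "even (deg en R v)" using F(3)[OF v] deg_R[of v] by (metis even_add)
    then have "even (net en' R v)" using even_deg_iff_even_net[OF finR] en'(1)[OF order_refl] by metis
    then show ?thesis using en'(2)[of v] by presburger
  qed
  have part: "even (deg en (Q i) v) \<and> \<bar>real (deg en (Q i) v) - \<epsilon> i * real (deg en E v)\<bar> < 2"
    if v: "v \<in> V" and i: "i \<in> {2..k}" for v i
  proof -
    have QR: "Q i \<subseteq> R" and proportion: "proportional en' (1 / real (k - 1)) R (Q i)" using Q(4)[OF i] by auto
    have finQ: "finite (Q i)" using QR finR finite_subset by blast
    define a where "a = enddeg en' True R v"
    define b where "b = enddeg en' True (Q i) v"
    have "\<bar>real_of_int (net en' (Q i) v)\<bar> < 1"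
      using proportion net_R[OF v] unfolding proportional_def by (metis diff_zero mult_zero_right of_int_0)
    then have "net en' (Q i) v = 0" by linarith
    then have degQ: "int (deg en (Q i) v) = 2 * b"
      using deg_eq_enddeg[OF finQ, of en' v] en'(1)[OF QR] unfolding net_def b_def by simp
    have degR: "int (deg en R v) = 2 * a"
      using deg_eq_enddeg[OF finR, of en' v] en'(1)[OF order_refl] net_R[OF v] unfolding net_def a_def by simp
    have rR: "real (deg en R v) = 2 * real_of_int a" and rQ: "real (deg en (Q i) v) = 2 * real_of_int b"
      using degR degQ by linarith+
    have "\<bar>real (deg en R v) - (1 - \<epsilon> 1) * real (deg en E v)\<bar> < 2"
      using F(4)[OF v] deg_R[of v] by (simp add: algebra_simps)
    then have "\<bar>real_of_int a - real (k - 1) * (\<epsilon> i * real (deg en E v) / 2)\<bar> < 1"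
      unfolding rest[OF i, symmetric] rR by (simp add: mult.assoc)
    moreover have "\<bar>real_of_int b - 1 / real (k - 1) * real_of_int a\<bar> < 1"
      using proportion unfolding proportional_def a_def b_def by blast
    moreover have "k - 1 > 0" using i by auto
    ultimately have "\<bar>real_of_int b - \<epsilon> i * real (deg en E v) / 2\<bar> < 1" by (rule rounding_trans[rotated])
    then have "\<bar>real (deg en (Q i) v) - \<epsilon> i * real (deg en E v)\<bar> < 2" unfolding rQ by linarith
    moreover have "even (deg en (Q i) v)" using degQ by presburger
    ultimately show ?thesis by simp
  qed
  have "\<bar>real (deg en (Q i) v) - \<epsilon> i * real (deg en E v)\<bar> < 2" if "v \<in> V" "i \<in> {1..k}" for v i
    using part[OF that(1), of i] F(4)[OF that(1)] that(2) Q(3) by (cases "i = 1") auto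
  then show ?thesis using Q(1-3) F(3) part by metis
qed

section \<open>Multigraphs with unordered ends\<close>

lemma ends_pairing_exists: "\<exists>en. \<forall>e. ends G e = Upair (en e False) (en e True)"
proof -
  have "\<exists>g. ends G e = Upair (g False) (g True)" for e
  proof -
    obtain a b where "ends G e = Upair a b" by (cases "ends G e" rule: uprod_exhaust)
    then show ?thesis by (intro exI[of _ "\<lambda>c. if c then b else a"]) simp
  qed
  then show ?thesis by metis
qed

lemma degree_eq_deg:
  assumes "finite (edges H)" "\<And>e. e \<in> edges H \<Longrightarrow> ends H e = Upair (en e False) (en e True)"
  shows "degree H v = deg en (edges H) v"
  unfolding degree_def deg_eq_sum[OF assms(1)]
  by (intro sum.cong refl) (auto simp: assms(2) end_multiplicity_def)

lemma cut_degree_eq_card_cut: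
  assumes "\<And>e. e \<in> edges H \<Longrightarrow> ends H e = Upair (en e False) (en e True)"
  shows "cut_degree H A = card (edge_cut en (edges H) A)"
proof -
  have "{e \<in> edges H. \<exists>x y. ends H e = Upair x y \<and> x \<in> A \<and> y \<notin> A} = edge_cut en (edges H) A"
  proof -
    have "(\<exists>x y. ends H e = Upair x y \<and> x \<in> A \<and> y \<notin> A) \<longleftrightarrow> (en e False \<in> A) \<noteq> (en e True \<in> A)"
      if "e \<in> edges H" for e
      unfolding assms[OF that] Upair_inject by blast
    then show ?thesis unfolding edge_cut_def by blast
  qed
  then show ?thesis unfolding cut_degree_def by simp
qed

lemma factor_decomposition_of_edge_partition:
  assumes "disjoint_family_on Q I" "(\<Union>i\<in>I. Q i) = edges G"
  shows "factor_decomposition G I (\<lambda>i. G\<lparr>edges := Q i\<rparr>)"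
  using assms unfolding factor_decomposition_def factor_def by auto

theorem corollary8p9:
  fixes G :: "('v, 'e) multigraph"
    and k :: nat
    and \<epsilon> :: "nat \<Rightarrow> real"
  assumes "finite_multigraph G"
    and "\<And>i. i \<in> {1..k} \<Longrightarrow> 0 \<le> \<epsilon> i"
    and "(\<Sum>i=1..k. \<epsilon> i) = 1"
    and "\<And>i j. i \<in> {2..k} \<Longrightarrow> j \<in> {2..k} \<Longrightarrow> \<epsilon> i = \<epsilon> j"
  shows "(\<exists>H :: nat \<Rightarrow> ('v, 'e) multigraph.
            factor_decomposition G {1..k} H \<and>
            (\<forall>v\<in>verts G. \<forall>i\<in>{1..k}.
               \<bar>real (degree (H i) v) - \<epsilon> i * real (degree G v)\<bar> < 2) \<and>
            (\<forall>v\<in>verts G. \<exists>\<^sub>\<le>\<^sub>1 j. j \<in> {1..k} \<and> odd (degree (H j) v)))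
       \<and> (\<epsilon> 1 > 0 \<and> odd_edge_connected G \<lceil>1 / \<epsilon> 1\<rceil> \<longrightarrow>
          (\<exists>H :: nat \<Rightarrow> ('v, 'e) multigraph.
            factor_decomposition G {1..k} H \<and>
            (\<forall>v\<in>verts G. \<forall>i\<in>{1..k}.
               \<bar>real (degree (H i) v) - \<epsilon> i * real (degree G v)\<bar> < 2) \<and>
            (\<forall>v\<in>verts G. \<exists>\<^sub>\<le>\<^sub>1 j. j \<in> {1..k} \<and> odd (degree (H j) v)) \<and>
            (\<forall>v\<in>verts G. odd (degree G v) \<longrightarrow> odd (degree (H 1) v))))"
proof -
  interpret finite_multigraph G by fact
  obtain en where en: "\<And>e. ends G e = Upair (en e False) (en e True)"
    using ends_pairing_exists[of G] by blast
  have en_in: "en e b \<in> verts G" if "e \<in> edges G" for e b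
    using ends_in_verts[OF that] unfolding en by (cases b) auto
  have degG: "degree G v = deg en (edges G) v" for v
    by (rule degree_eq_deg) (simp_all add: finite_edges en)
  have degH: "degree (G\<lparr>edges := S\<rparr>) v = deg en S v" if "S \<subseteq> edges G" for S v
    using degree_eq_deg[of "G\<lparr>edges := S\<rparr>" en v] finite_subset[OF that finite_edges] en by simp
  have k: "1 \<le> k" using assms(3) by (cases k) auto
  have sum1: "\<epsilon> 1 + (\<Sum>i\<in>{2..k}. \<epsilon> i) = 1"
    using assms(3) k by (simp add: sum.atLeast_Suc_atMost numeral_2_eq_2)
  have "0 \<le> (\<Sum>i\<in>{2..k}. \<epsilon> i)" using assms(2) by (intro sum_nonneg) auto
  then have \<epsilon>1: "0 \<le> \<epsilon> 1" "\<epsilon> 1 \<le> 1" using sum1 assms(2)[of 1] k by auto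
  have k1: "k = 1 \<longrightarrow> \<epsilon> 1 = 1" using sum1 by auto
  have rest: "real (k - 1) * \<epsilon> i = 1 - \<epsilon> 1" if i: "i \<in> {2..k}" for i
  proof -
    have "(\<Sum>j\<in>{2..k}. \<epsilon> j) = (\<Sum>j\<in>{2..k}. \<epsilon> i)" by (rule sum.cong[OF refl]) (rule assms(4)[OF _ i])
    then show ?thesis using sum1 by simp
  qed
  have *: "\<exists>H :: nat \<Rightarrow> ('v, 'e) multigraph. factor_decomposition G {1..k} H \<and>
      (\<forall>i\<in>{1..k}. \<forall>v. degree (H i) v = deg en (Q i) v)"
    if "disjoint_family_on Q {1..k}" "(\<Union>i\<in>{1..k}. Q i) = edges G" for Q :: "nat \<Rightarrow> 'e set"
  proof -
    have "Q i \<subseteq> edges G" if "i \<in> {1..k}" for i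
      unfolding \<open>(\<Union>i\<in>{1..k}. Q i) = edges G\<close>[symmetric] using that by (rule UN_upper)
    then show ?thesis
      using factor_decomposition_of_edge_partition[OF that] degH
      by (intro exI[of _ "\<lambda>i. G\<lparr>edges := Q i\<rparr>"]) simp
  qed
  show ?thesis
  proof (intro conjI impI)
    obtain Q :: "nat \<Rightarrow> 'e set" where Q: "disjoint_family_on Q {1..k}" "(\<Union>i\<in>{1..k}. Q i) = edges G"
      "\<forall>v. \<forall>i\<in>{1..k}. \<bar>real (deg en (Q i) v) - \<epsilon> i * real (deg en (edges G) v)\<bar> < 2"
      "\<forall>v. \<exists>\<^sub>\<le>\<^sub>1 j. j \<in> {1..k} \<and> odd (deg en (Q j) v)"
      using balanced_decomposition[where \<epsilon> = \<epsilon> and k = k and en = en, OF finite_edges k k1 \<epsilon>1 rest assms(2)]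
      by blast
    obtain H where H: "factor_decomposition G {1..k} H" "\<forall>i\<in>{1..k}. \<forall>v. degree (H i) v = deg en (Q i) v"
      using *[OF Q(1,2)] by blast
    show "\<exists>H :: nat \<Rightarrow> ('v, 'e) multigraph.
            factor_decomposition G {1..k} H \<and>
            (\<forall>v\<in>verts G. \<forall>i\<in>{1..k}.
               \<bar>real (degree (H i) v) - \<epsilon> i * real (degree G v)\<bar> < 2) \<and>
            (\<forall>v\<in>verts G. \<exists>\<^sub>\<le>\<^sub>1 j. j \<in> {1..k} \<and> odd (degree (H j) v))"
    proof (intro exI[of _ H] conjI ballI)
      show "factor_decomposition G {1..k} H" by (rule H(1))
      show "\<bar>real (degree (H i) v) - \<epsilon> i * real (degree G v)\<bar> < 2" if "i \<in> {1..k}" for v i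
        using H(2) Q(3) that by (simp add: degG)
      show "\<exists>\<^sub>\<le>\<^sub>1 j. j \<in> {1..k} \<and> odd (degree (H j) v)" for v
        using Q(4)[rule_format, of v] H(2) unfolding Uniq_def by metis
    qed
  next
    assume conn: "\<epsilon> 1 > 0 \<and> odd_edge_connected G \<lceil>1 / \<epsilon> 1\<rceil>"
    have cuts: "1 \<le> \<epsilon> 1 * real (card (edge_cut en (edges G) C))" if "C \<subseteq> verts G" "odd (card (edge_cut en (edges G) C))" for C
    proof -
      have "cut_degree G C = card (edge_cut en (edges G) C)" by (rule cut_degree_eq_card_cut) (rule en)
      then have "\<lceil>1 / \<epsilon> 1\<rceil> \<le> int (card (edge_cut en (edges G) C))"
        using conn that unfolding odd_edge_connected_def by metis
      then have "1 / \<epsilon> 1 \<le> real (card (edge_cut en (edges G) C))" by (simp add: ceiling_le_iff)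
      then show ?thesis using conn by (simp add: divide_le_eq mult.commute)
    qed
    obtain Q :: "nat \<Rightarrow> 'e set" where Q: "disjoint_family_on Q {1..k}" "(\<Union>i\<in>{1..k}. Q i) = edges G"
      "\<forall>v\<in>verts G. \<forall>i\<in>{1..k}. \<bar>real (deg en (Q i) v) - \<epsilon> i * real (deg en (edges G) v)\<bar> < 2"
      "\<forall>v\<in>verts G. \<forall>i\<in>{2..k}. even (deg en (Q i) v)"
      "\<forall>v\<in>verts G. even (deg en (Q 1) v) \<longleftrightarrow> even (deg en (edges G) v)"
      using parity_decomposition[where \<epsilon> = \<epsilon> and k = k and en = en,
          OF finite_verts finite_edges en_in k k1 \<epsilon>1 rest cuts] by blast
    obtain H where H: "factor_decomposition G {1..k} H" "\<forall>i\<in>{1..k}. \<forall>v. degree (H i) v = deg en (Q i) v"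
      using *[OF Q(1,2)] by blast
    have one: "j = 1" if "v \<in> verts G" "j \<in> {1..k}" "odd (degree (H j) v)" for v j
    proof (rule ccontr)
      assume "j \<noteq> 1"
      then have "j \<in> {2..k}" using that(2) by auto
      then show False using Q(4) H(2) that by auto
    qed
    have "\<forall>v\<in>verts G. \<exists>\<^sub>\<le>\<^sub>1 j. j \<in> {1..k} \<and> odd (degree (H j) v)"
      unfolding Uniq_def using one by metis
    moreover have "\<forall>v\<in>verts G. odd (degree G v) \<longrightarrow> odd (degree (H 1) v)"
      using H(2) Q(5) k by (simp add: degG)
    moreover have "\<forall>v\<in>verts G. \<forall>i\<in>{1..k}. \<bar>real (degree (H i) v) - \<epsilon> i * real (degree G v)\<bar> < 2"
      using H(2) Q(3) by (simp add: degG)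
    ultimately show "\<exists>H :: nat \<Rightarrow> ('v, 'e) multigraph.
            factor_decomposition G {1..k} H \<and>
            (\<forall>v\<in>verts G. \<forall>i\<in>{1..k}.
               \<bar>real (degree (H i) v) - \<epsilon> i * real (degree G v)\<bar> < 2) \<and>
            (\<forall>v\<in>verts G. \<exists>\<^sub>\<le>\<^sub>1 j. j \<in> {1..k} \<and> odd (degree (H j) v)) \<and>
            (\<forall>v\<in>verts G. odd (degree G v) \<longrightarrow> odd (degree (H 1) v))"
      using H(1) by blast
  qed
qed

end
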